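(* Let $p$ be an odd prime. For any $n\ge 1$, the set of elements $$q^I=R_{n;0}^{\epsilon_1}q_{n,0}^{i_1}\cdots R_{n;n-1}^{\epsilon_n}q_{n,n-1}^{i_n}$$ for $i_1\in\mathbb{Z}$, $i_s\ge 0$ for $2\le s\le n$, $\epsilon_s\in\{0,1\}$ and $2i_1+b(I)\ge 0$, forms an additive basis for $\mathscr{B}[n]$.
   Context: $\mathbb{V}_n=(\mathbb{Z}/p)^n$; $H^*B\mathbb{V}_n=E(e_1,\dots,e_n)\otimes\mathbb{F}_p[x_1,\dots,x_n]$ (mod $p$ cohomology), $|e_i|=1$, $x_i=\beta e_i$, $|x_i|=2$. $GL_n=GL_n(\mathbb{F}_p)$ acts by algebra automorphisms with $(a_{ij})x_s=\sum_ia_{is}x_i$, $(a_{ij})e_s=\sum_ia_{is}e_i$. Put $[r_1,\dots,r_n]=\det(x_i^{p^{r_j}})$, $L_{n,i}=[0,\dots,\hat i,\dots,n]$ (omit $i$), $L_n=L_{n,n}$, $q_{n,i}=L_{n,i}/L_n$ ($0\le i\le n-1$). For $0\le s_1<\cdots<s_k\le n-1$ let $M_{n;s_1,\dots,s_k}=\frac1{k!}\det$ of the $n\times n$ matrix whose first $k$ rows are all $(e_1,\dots,e_n)$ and whose remaining rows are $(x_1^{p^r},\dots,x_n^{p^r})$ for $r\in\{0,\dots,n-1\}\setminus\{s_1,\dots,s_k\}$ in increasing order (determinant expanded as $\sum_\pi\mathrm{sgn}(\pi)a_{1\pi(1)}\cdots a_{n\pi(n)}$), and $R_{n;s_1,\dots,s_k}=M_{n;s_1,\dots,s_k}L_n^{p-2}$.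 $\mathscr{B}[n]$ is the subalgebra of $(H^*B\mathbb{V}_n)^{GL_n}$ generated by $q_{n,i}$ ($0\le i\le n-1$), $R_{n;s}$ ($0\le s\le n-1$) and $R_{n;s,t}$ ($0\le s<t\le n-1$). For $I=(\epsilon_1,i_1,\dots,\epsilon_n,i_n)$: $b(I)=\sum_s\epsilon_s$. If $i_1<0$ the product $q^I$ is interpreted in the localization inverting $q_{n,0}$, using $R_{n;s_1}\cdots R_{n;s_k}=(-1)^{k(k-1)/2}R_{n;s_1,\dots,s_k}q_{n,0}^{k-1}$; under the condition $2i_1+b(I)\ge 0$ it lies in $H^*B\mathbb{V}_n$. *)

theory Defs
  imports
    "HOL-Library.Poly_Mapping"
    "HOL-Computational_Algebra.Polynomial_Factorial"
    "Jordan_Normal_Form.Determinant"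
    "Berlekamp_Zassenhaus.Finite_Field"
begin

section \<open>Exterior algebras\<close>

text \<open>
  \<open>'a exterior\<close> is the exterior algebra over the commutative ring \<open>'a\<close> on generators
  \<open>e\<^sub>0, e\<^sub>1, e\<^sub>2, \<dots>\<close>: an element is given by its coefficients with respect to the basis
  of the monomials \<open>e\<^sub>S = e\<^bsub>s\<^sub>1\<^esub> \<cdots> e\<^bsub>s\<^sub>k\<^esub>\<close>, where \<open>S = {s\<^sub>1 < \<cdots> < s\<^sub>k}\<close> is a finite set
  of indices.
\<close>

typedef (overloaded) 'a exterior =
  "{f :: nat set \<Rightarrow> 'a::zero. finite {S. f S \<noteq> 0} \<and> (\<forall>S. f S \<noteq> 0 \<longrightarrow> finite S)}"
  morphisms ext_coeff Abs_exterior
  by (rule exI[of _ "\<lambda>_. 0"]) auto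

setup_lifting type_definition_exterior

lemma exterior_eqI: "(\<And>S. finite S \<Longrightarrow> ext_coeff f S = ext_coeff g S) \<Longrightarrow> f = g"
  by transfer (metis ext)

lemma ext_coeff_infinite: "infinite S \<Longrightarrow> ext_coeff f S = 0"
  by transfer auto

lemma finite_ext_supp: "finite {S. ext_coeff f S \<noteq> 0}"
  by transfer auto

text \<open>\<open>e\<^sub>S e\<^sub>T = ext_sign S T e\<^bsub>S \<union> T\<^esub>\<close> for disjoint \<open>S\<close> and \<open>T\<close>.\<close>

definition ext_sign :: "nat set \<Rightarrow> nat set \<Rightarrow> 'a::comm_ring_1" where
  "ext_sign S T = (- 1) ^ card {(s, t). s \<in> S \<and> t \<in> T \<and> t < s}"

lemma finite_inversions: "finite S \<Longrightarrow> finite T \<Longrightarrow> finite {(s::nat, t::nat). s \<in> S \<and> t \<in> T \<and> t < s}"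
  by (rule finite_subset[of _ "S \<times> T"]) auto

lemma ext_sign_union_left:
  assumes "finite A" "finite B" "finite C" "A \<inter> B = {}"
  shows "ext_sign (A \<union> B) C = (ext_sign A C * ext_sign B C :: 'a::comm_ring_1)"
proof -
  have "{(s, t). s \<in> A \<union> B \<and> t \<in> C \<and> t < s} =
        {(s, t). s \<in> A \<and> t \<in> C \<and> t < s} \<union> {(s, t). s \<in> B \<and> t \<in> C \<and> t < s}" by auto
  moreover have "{(s, t). s \<in> A \<and> t \<in> C \<and> t < s} \<inter> {(s, t). s \<in> B \<and> t \<in> C \<and> t < s} = {}"
    using assms(4) by auto
  ultimately show ?thesis
    by (simp add: ext_sign_def card_Un_disjoint finite_inversions assms power_add)
qed

lemma ext_sign_union_right:
  assumes "finite A" "finite B" "finite C" "B \<inter> C = {}"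
  shows "ext_sign A (B \<union> C) = (ext_sign A B * ext_sign A C :: 'a::comm_ring_1)"
proof -
  have "{(s, t). s \<in> A \<and> t \<in> B \<union> C \<and> t < s} =
        {(s, t). s \<in> A \<and> t \<in> B \<and> t < s} \<union> {(s, t). s \<in> A \<and> t \<in> C \<and> t < s}" by auto
  moreover have "{(s, t). s \<in> A \<and> t \<in> B \<and> t < s} \<inter> {(s, t). s \<in> A \<and> t \<in> C \<and> t < s} = {}"
    using assms(4) by auto
  ultimately show ?thesis
    by (simp add: ext_sign_def card_Un_disjoint finite_inversions assms power_add)
qed

lemma ext_sign_empty [simp]: "ext_sign {} T = 1" "ext_sign S {} = 1"
  by (simp_all add: ext_sign_def)

instantiation exterior :: (comm_ring_1) ring_1
begin

lift_definition zero_exterior :: "'a exterior" is "\<lambda>_. 0" by auto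

lift_definition one_exterior :: "'a exterior" is "\<lambda>S. if S = {} then 1 else 0"
  by (auto split: if_splits)

lift_definition plus_exterior :: "'a exterior \<Rightarrow> 'a exterior \<Rightarrow> 'a exterior" is
  "\<lambda>f g S. f S + g S"
proof -
  fix f g :: "nat set \<Rightarrow> 'a"
  assume *: "finite {S. f S \<noteq> 0} \<and> (\<forall>S. f S \<noteq> 0 \<longrightarrow> finite S)"
    "finite {S. g S \<noteq> 0} \<and> (\<forall>S. g S \<noteq> 0 \<longrightarrow> finite S)"
  have "{S. f S + g S \<noteq> 0} \<subseteq> {S. f S \<noteq> 0} \<union> {S. g S \<noteq> 0}" by auto
  with * show "finite {S. f S + g S \<noteq> 0} \<and> (\<forall>S. f S + g S \<noteq> 0 \<longrightarrow> finite S)"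
    by (metis (mono_tags, lifting) add.right_neutral finite_UnI finite_subset)
qed

lift_definition uminus_exterior :: "'a exterior \<Rightarrow> 'a exterior" is "\<lambda>f S. - f S" by auto

lift_definition minus_exterior :: "'a exterior \<Rightarrow> 'a exterior \<Rightarrow> 'a exterior" is
  "\<lambda>f g S. f S - g S"
proof -
  fix f g :: "nat set \<Rightarrow> 'a"
  assume *: "finite {S. f S \<noteq> 0} \<and> (\<forall>S. f S \<noteq> 0 \<longrightarrow> finite S)"
    "finite {S. g S \<noteq> 0} \<and> (\<forall>S. g S \<noteq> 0 \<longrightarrow> finite S)"
  have "{S. f S - g S \<noteq> 0} \<subseteq> {S. f S \<noteq> 0} \<union> {S. g S \<noteq> 0}" by auto
  with * show "finite {S. f S - g S \<noteq> 0} \<and> (\<forall>S. f S - g S \<noteq> 0 \<longrightarrow> finite S)"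
    by (metis (mono_tags, lifting) diff_zero finite_UnI finite_subset)
qed

lift_definition times_exterior :: "'a exterior \<Rightarrow> 'a exterior \<Rightarrow> 'a exterior" is
  "\<lambda>f g S. \<Sum>T\<in>Pow S. ext_sign T (S - T) * f T * g (S - T)"
proof -
  fix f g :: "nat set \<Rightarrow> 'a"
  assume *: "finite {S. f S \<noteq> 0} \<and> (\<forall>S. f S \<noteq> 0 \<longrightarrow> finite S)"
    "finite {S. g S \<noteq> 0} \<and> (\<forall>S. g S \<noteq> 0 \<longrightarrow> finite S)"
  let ?h = "\<lambda>S. \<Sum>T\<in>Pow S. ext_sign T (S - T) * f T * g (S - T)"
  have sub: "{S. ?h S \<noteq> 0} \<subseteq> (\<lambda>(T, U). T \<union> U) ` ({S. f S \<noteq> 0} \<times> {S. g S \<noteq> 0})"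
  proof
    fix S assume "S \<in> {S. ?h S \<noteq> 0}"
    then obtain T where T: "T \<in> Pow S" "ext_sign T (S - T) * f T * g (S - T) \<noteq> 0"
      by (metis (mono_tags, lifting) mem_Collect_eq sum.neutral)
    then have "f T \<noteq> 0" "g (S - T) \<noteq> 0" by auto
    moreover have "S = T \<union> (S - T)" using T by auto
    ultimately show "S \<in> (\<lambda>(T, U). T \<union> U) ` ({S. f S \<noteq> 0} \<times> {S. g S \<noteq> 0})"
      by (intro image_eqI[of _ _ "(T, S - T)"]) auto
  qed
  have "finite S" if "?h S \<noteq> 0" for S
    using subsetD[OF sub, of S] that * by auto
  moreover have "finite {S. ?h S \<noteq> 0}"
    using sub * by (meson finite_SigmaI finite_imageI finite_subset)
  ultimately show "finite {S. ?h S \<noteq> 0} \<and> (\<forall>S. ?h S \<noteq> 0 \<longrightarrow> finite S)" by blast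
qed

instance
proof
  fix f g h :: "'a exterior"
  show "f + g + h = f + (g + h)" by transfer (simp add: add.assoc)
  show "f + g = g + f" by transfer (simp add: add.commute)
  show "0 + f = f" by transfer simp
  show "- f + f = 0" by transfer simp
  show "f - g = f + - g" by transfer simp
  show "(f + g) * h = f * h + g * h"
    by transfer (simp add: algebra_simps sum.distrib)
  show "f * (g + h) = f * g + f * h"
    by transfer (simp add: algebra_simps sum.distrib)
  show "(0::'a exterior) \<noteq> 1" by transfer (metis zero_neq_one)
  show "1 * f = f"
  proof (rule exterior_eqI)
    fix S :: "nat set" assume S: "finite S"
    have "ext_coeff (1 * f) S =
        (\<Sum>T\<in>Pow S. if T = {} then ext_coeff f S else 0)"
      by (simp add: times_exterior.rep_eq one_exterior.rep_eq) (rule sum.cong, auto)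
    then show "ext_coeff (1 * f) S = ext_coeff f S" using S by simp
  qed
  show "f * 1 = f"
  proof (rule exterior_eqI)
    fix S :: "nat set" assume S: "finite S"
    have "ext_coeff (f * 1) S = (\<Sum>T\<in>Pow S. if T = S then ext_coeff f S else 0)"
      by (simp add: times_exterior.rep_eq one_exterior.rep_eq) (rule sum.cong, auto)
    then show "ext_coeff (f * 1) S = ext_coeff f S" using S by simp
  qed
  show "f * g * h = f * (g * h)"
  proof (rule exterior_eqI)
    fix S :: "nat set" assume S: "finite S"
    let ?f = "ext_coeff f" and ?g = "ext_coeff g" and ?h = "ext_coeff h"
    let ?F = "\<lambda>(U, T). ext_sign U (S - U) * ext_sign T (U - T) * ?f T * ?g (U - T) * ?h (S - U)"
    let ?G = "\<lambda>(T, V). ext_sign T (S - T) * ext_sign V (S - T - V) * ?f T * ?g V * ?h (S - T - V)"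
    have "ext_coeff (f * g * h) S = (\<Sum>U\<in>Pow S. \<Sum>T\<in>Pow U. ?F (U, T))"
      by (simp add: times_exterior.rep_eq sum_distrib_left sum_distrib_right mult_ac)
    also have "\<dots> = sum ?F (Sigma (Pow S) Pow)"
      using S finite_subset by (subst sum.Sigma) auto
    also have "\<dots> = sum ?G (Sigma (Pow S) (\<lambda>T. Pow (S - T)))"
    proof (rule sum.reindex_bij_witness[of _ "\<lambda>(T, V). (T \<union> V, T)" "\<lambda>(U, T). (T, U - T)"])
      fix x assume "x \<in> Sigma (Pow S) Pow"
      then obtain U T where x: "x = (U, T)" "U \<subseteq> S" "T \<subseteq> U"
        by (elim SigmaE) simp
      have fin: "finite U" "finite T"
        using S x(2,3) by (meson finite_subset)+
      have eq: "S - T - (U - T) = S - U" "S - T = (U - T) \<union> (S - U)" "U = T \<union> (U - T)"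
        using x by auto
      have "(ext_sign U (S - U) :: 'a) = ext_sign T (S - U) * ext_sign (U - T) (S - U)"
        using ext_sign_union_left[of T "U - T" "S - U"] fin S eq(3) by auto
      moreover have "(ext_sign T (S - T) :: 'a) = ext_sign T (U - T) * ext_sign T (S - U)"
        using ext_sign_union_right[of T "U - T" "S - U"] fin S eq(2) by auto
      ultimately show "?G (case x of (U, T) \<Rightarrow> (T, U - T)) = ?F x"
        using x eq(1) by (simp add: mult_ac)
    qed auto
    also have "\<dots> = (\<Sum>T\<in>Pow S. \<Sum>V\<in>Pow (S - T). ?G (T, V))"
      using S by (subst sum.Sigma) auto
    also have "\<dots> = ext_coeff (f * (g * h)) S"
      by (simp add: times_exterior.rep_eq sum_distrib_left sum_distrib_right mult_ac)
    finally show "ext_coeff (f * g * h) S = ext_coeff (f * (g * h)) S" .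
  qed
qed

end

lift_definition ext_const :: "'a::zero \<Rightarrow> 'a exterior" is "\<lambda>c S. if S = {} then c else 0"
  by (auto split: if_splits)

lift_definition ext_gen :: "nat \<Rightarrow> 'a::zero_neq_one exterior" is "\<lambda>i S. if S = {i} then 1 else 0"
  by (auto split: if_splits)

section \<open>The cohomology ring and the action of the general linear group\<close>

text \<open>
  The prime \<open>p\<close> is the cardinality of the type \<open>'p\<close>, and \<open>'p mod_ring\<close> is the field of
  integers modulo \<open>p\<close>. All indices (of variables, generators, rows and columns) start at 0.
\<close>

type_synonym 'p fpoly = "(nat \<Rightarrow>\<^sub>0 nat) \<Rightarrow>\<^sub>0 'p mod_ring"

definition PC :: "'p::prime_card mod_ring \<Rightarrow> 'p fpoly" where
  "PC c = Poly_Mapping.single 0 c"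

definition PX :: "nat \<Rightarrow> 'p::prime_card fpoly" where
  "PX i = Poly_Mapping.single (Poly_Mapping.single i 1) 1"

text \<open>Over \<open>'p fpoly\<close>, \<open>ext_gen i\<close> is the class \<open>e\<^bsub>i+1\<^esub>\<close> and \<open>ext_const (PX i)\<close> is \<open>x\<^bsub>i+1\<^esub>\<close>.\<close>

definition HBV :: "nat \<Rightarrow> 'p::prime_card fpoly exterior set" where
  "HBV n = {h. \<forall>S. ext_coeff h S \<noteq> 0 \<longrightarrow>
      S \<subseteq> {0..<n} \<and> (\<forall>m\<in>Poly_Mapping.keys (ext_coeff h S). Poly_Mapping.keys m \<subseteq> {0..<n})}"

definition gl_poly :: "'p::prime_card mod_ring mat \<Rightarrow> 'p fpoly \<Rightarrow> 'p fpoly" where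
  "gl_poly A f = (\<Sum>m\<in>Poly_Mapping.keys f. PC (Poly_Mapping.lookup f m) *
     (\<Prod>s\<in>Poly_Mapping.keys m. (\<Sum>i = 0..<dim_row A. PC (A $$ (i, s)) * PX i) ^ Poly_Mapping.lookup m s))"

text \<open>The algebra automorphism with \<open>x\<^sub>s \<mapsto> \<Sum>\<^sub>i a\<^bsub>is\<^esub> x\<^sub>i\<close> and \<open>e\<^sub>s \<mapsto> \<Sum>\<^sub>i a\<^bsub>is\<^esub> e\<^sub>i\<close>, written out on the
  basis of monomials.\<close>

definition gl_act ::
  "'p::prime_card mod_ring mat \<Rightarrow> 'p fpoly exterior \<Rightarrow> 'p fpoly exterior" where
  "gl_act A h = (\<Sum>S | ext_coeff h S \<noteq> 0. ext_const (gl_poly A (ext_coeff h S)) *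
     prod_list (map (\<lambda>s. \<Sum>i = 0..<dim_row A. ext_const (PC (A $$ (i, s))) * ext_gen i)
       (sorted_list_of_set S)))"

definition gl_invariants :: "nat \<Rightarrow> 'p::prime_card fpoly exterior set" where
  "gl_invariants n =
     {h \<in> HBV n. \<forall>A \<in> carrier_mat n n. invertible_mat A \<longrightarrow> gl_act A h = h}"

section \<open>Dickson and Mui invariants\<close>

definition bracket :: "nat list \<Rightarrow> 'p::prime_card fpoly" where
  "bracket r = det (mat (length r) (length r) (\<lambda>(i, j). PX i ^ (CARD('p) ^ (r ! j))))"

definition Lni :: "nat \<Rightarrow> nat \<Rightarrow> 'p::prime_card fpoly" where
  "Lni n i = bracket (filter (\<lambda>r. r \<noteq> i) [0..<Suc n])"

definition Ln :: "nat \<Rightarrow> 'p::prime_card fpoly" where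
  "Ln n = Lni n n"

text \<open>Over a noncommutative ring the order of the factors matters, so the library determinant
  is not applicable here.\<close>

definition row_det :: "nat \<Rightarrow> (nat \<Rightarrow> nat \<Rightarrow> 'a::ring_1) \<Rightarrow> 'a" where
  "row_det n a = (\<Sum>\<pi> | \<pi> permutes {0..<n}.
     of_int (sign \<pi>) * prod_list (map (\<lambda>i. a i (\<pi> i)) [0..<n]))"

text \<open>The set \<open>S = {s\<^sub>1, \<dots>, s\<^sub>k}\<close> consists of indices below \<open>n\<close>. The factor \<open>1 / k!\<close> is taken
  in the field with \<open>p\<close> elements, so the definition is meaningful for \<open>k < p\<close>; it is only
  used with \<open>k \<le> 2\<close> and \<open>p\<close> odd.\<close>

definition Mn :: "nat \<Rightarrow> nat set \<Rightarrow> 'p::prime_card fpoly exterior" where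
  "Mn n S = ext_const (PC (inverse (of_nat (fact (card S))))) *
     row_det n (\<lambda>i j. if i < card S then ext_gen j
       else ext_const (PX j ^ (CARD('p) ^ (sorted_list_of_set ({0..<n} - S) ! (i - card S)))))"

definition Rn :: "nat \<Rightarrow> nat set \<Rightarrow> 'p::prime_card fpoly exterior" where
  "Rn n S = Mn n S * ext_const (Ln n ^ (CARD('p) - 2))"

section \<open>The localized ring\<close>

text \<open>The cohomology ring embeds into the exterior algebra over the fraction field of the
  polynomial ring, and so does its localization at \<open>q\<^bsub>n,0\<^esub>\<close>; the quotients \<open>L\<^bsub>n,i\<^esub> / L\<^sub>n\<close> and the
  negative powers of \<open>q\<^bsub>n,0\<^esub>\<close> are formed there.\<close>

definition to_loc :: "'p::prime_card fpoly exterior \<Rightarrow> 'p fpoly fract exterior" where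
  "to_loc h = Abs_exterior (\<lambda>S. to_fract (ext_coeff h S))"

lemma ext_coeff_to_loc: "ext_coeff (to_loc h) S = to_fract (ext_coeff h S)"
proof -
  have "{S. to_fract (ext_coeff h S) \<noteq> 0} \<subseteq> {S. ext_coeff h S \<noteq> 0}" by auto
  then have "finite {S. to_fract (ext_coeff h S) \<noteq> 0}"
    using finite_ext_supp finite_subset by blast
  moreover have "to_fract (ext_coeff h S) \<noteq> 0 \<longrightarrow> finite S" for S
    using ext_coeff_infinite[of S h] by auto
  ultimately show ?thesis
    unfolding to_loc_def by (subst Abs_exterior_inverse) blast+
qed

definition qni :: "nat \<Rightarrow> nat \<Rightarrow> 'p::prime_card fpoly fract" where
  "qni n i = to_fract (Lni n i) / to_fract (Ln n)"

definition fp_scale ::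
  "'p::prime_card mod_ring \<Rightarrow> 'p fpoly fract exterior \<Rightarrow> 'p fpoly fract exterior" where
  "fp_scale c h = ext_const (to_fract (PC c)) * h"

lemma ext_coeff_const_mult: "ext_coeff (ext_const c * h) S = c * ext_coeff h S"
proof (cases "finite S")
  case True
  have "ext_coeff (ext_const c * h) S = (\<Sum>T\<in>Pow S. if T = {} then c * ext_coeff h S else 0)"
    by (simp add: times_exterior.rep_eq ext_const.rep_eq) (rule sum.cong, auto)
  then show ?thesis using True by simp
qed (simp add: ext_coeff_infinite)

lemma PC_add: "PC (a + b) = PC a + PC b"
  by (simp add: PC_def single_add)

lemma PC_mult: "PC (a * b) = PC a * PC b"
  by (simp add: PC_def mult_single)

lemma PC_1: "PC 1 = 1"
  by (simp add: PC_def)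

global_interpretation fp: vector_space fp_scale
proof
  fix a b :: "'a mod_ring" and x y :: "'a fpoly fract exterior"
  show "fp_scale a (x + y) = fp_scale a x + fp_scale a y"
    by (simp add: fp_scale_def distrib_left)
  show "fp_scale (a + b) x = fp_scale a x + fp_scale b x"
    by (rule exterior_eqI)
      (simp add: fp_scale_def ext_coeff_const_mult plus_exterior.rep_eq PC_add distrib_right)
  show "fp_scale a (fp_scale b x) = fp_scale (a * b) x"
    by (rule exterior_eqI) (simp add: fp_scale_def ext_coeff_const_mult PC_mult mult.assoc)
  show "fp_scale 1 x = x"
    by (rule exterior_eqI) (simp add: fp_scale_def ext_coeff_const_mult PC_1)
qed

definition fp_subalgebra :: "'p::prime_card fpoly fract exterior set \<Rightarrow> bool" where
  "fp_subalgebra A \<longleftrightarrow> fp.subspace A \<and> 1 \<in> A \<and> (\<forall>x\<in>A. \<forall>y\<in>A. x * y \<in> A)"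

definition Bn_gens :: "nat \<Rightarrow> 'p::prime_card fpoly fract exterior set" where
  "Bn_gens n = {ext_const (qni n i) | i. i < n} \<union> {to_loc (Rn n {s}) | s. s < n}
     \<union> {to_loc (Rn n {s, t}) | s t. s < t \<and> t < n}"

text \<open>The generated subalgebra is formed inside the algebra of invariants, so the generators
  must be invariant elements of the cohomology ring for the hull to be meaningful (the
  intersection over the empty family is \<open>UNIV\<close>).\<close>

definition Bn :: "nat \<Rightarrow> 'p::prime_card fpoly fract exterior set" where
  "Bn n = (\<lambda>A. fp_subalgebra A \<and> A \<subseteq> to_loc ` gl_invariants n) hull Bn_gens n"

text \<open>A multi-index \<open>I = (\<epsilon>\<^sub>1, i\<^sub>1, \<dots>, \<epsilon>\<^sub>n, i\<^sub>n)\<close> is a pair of functions \<open>(\<epsilon>, i)\<close>, extended by 0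
  outside \<open>{0..<n}\<close>.\<close>

definition admissible :: "nat \<Rightarrow> ((nat \<Rightarrow> nat) \<times> (nat \<Rightarrow> int)) set" where
  "admissible n = {(\<epsilon>, i). (\<forall>s<n. \<epsilon> s \<in> {0, 1}) \<and> (\<forall>s. 1 \<le> s \<and> s < n \<longrightarrow> 0 \<le> i s)
     \<and> (\<forall>s\<ge>n. \<epsilon> s = 0 \<and> i s = 0) \<and> 0 \<le> 2 * i 0 + int (\<Sum>s = 0..<n. \<epsilon> s)}"

definition qI ::
  "nat \<Rightarrow> (nat \<Rightarrow> nat) \<times> (nat \<Rightarrow> int) \<Rightarrow> 'p::prime_card fpoly fract exterior" where
  "qI n = (\<lambda>(\<epsilon>, i).
     prod_list (map (\<lambda>s. to_loc (Rn n {s}) ^ \<epsilon> s * ext_const (qni n s powi i s)) [0..<n]))"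

end

theory Submission
  imports Defs
begin

text \<open>
  Over the fraction field, the Moore matrix \<open>(x\<^sub>j^(p^r))\<close> carries the generators \<open>e\<^sub>j\<close> of the exterior
  algebra to another basis \<open>f\<^sub>r\<close>. Substituting \<open>e\<^sub>j = \<Sum>\<^sub>r x\<^sub>j^(p^r) f\<^sub>r\<close> into the defining determinants
  gives \<open>R\<^bsub>n;s\<^esub> = \<plusminus> q\<^bsub>n,0\<^esub> f\<^sub>s\<close> and \<open>R\<^bsub>n;s,t\<^esub> = \<plusminus> q\<^bsub>n,0\<^esub> f\<^sub>s f\<^sub>t\<close>. So \<open>q\<^sup>I\<close> is, up to sign, a monomial in
  the \<open>q\<^bsub>n,i\<^esub>\<close> with nonnegative exponents times an exterior monomial \<open>f\<^sub>S\<close>, the exponent of \<open>q\<^bsub>n,0\<^esub>\<close> being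
  at least \<open>|S| / 2\<close>. These elements are visibly closed under multiplication up to sign and
  generated by the \<open>q\<^bsub>n,i\<^esub>\<close>, \<open>q\<^bsub>n,0\<^esub> f\<^sub>s\<close> and \<open>q\<^bsub>n,0\<^esub> f\<^sub>s f\<^sub>t\<close>; they are independent because the \<open>f\<^sub>S\<close> are
  independent over the fraction field and the Dickson invariants are algebraically independent.
\<close>

text \<open>The factor q_{n,0} has one source: the determinant M contributes L_n, the definition of
  R contributes L_n^(p-2), and L_n^(p-1) = q_{n,0} because L_{n,0} is the p-th power of L_n. One
  such factor pays for at most two of the f_s, which gives the bound |S|/2. Since q^I contains b(I)
  factors R, its exponent at q_{n,0} is i_1 + b(I), and the bound becomes 2 i_1 + b(I) \<ge> 0.
  Signs from reordering exponents are not computed but carried as some u in {1, -1}, which neither a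
  span nor a subalgebra notices. Two obstacles shape the proof. Determinants with anticommuting
  entries need their own multiplicativity, with a matrix of central scalars on the right. And the
  Dickson invariants must be shown algebraically independent, for which they are rebuilt by
  recursion on the number of variables. Invariance under GL_n also enters, since \<open>Bn\<close>
  intersects only subalgebras of the invariants.\<close>

lemma ext_coeff_sum: "ext_coeff (sum f A) S = (\<Sum>a\<in>A. ext_coeff (f a) S)"
  by (induction A rule: infinite_finite_induct)
    (auto simp: zero_exterior.rep_eq plus_exterior.rep_eq)

lemma ext_const_0 [simp]: "ext_const (0::'a::comm_ring_1) = 0"
  by transfer auto

lemma ext_const_1 [simp]: "ext_const (1::'a::comm_ring_1) = 1"
  by transfer auto

lemma ext_const_add: "ext_const (a + b :: 'a::comm_ring_1) = ext_const a + ext_const b"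
  by transfer auto

lemma ext_const_minus [simp]: "ext_const (- a :: 'a::comm_ring_1) = - ext_const a"
  by transfer auto

lemma ext_coeff_mult_const: "ext_coeff (h * ext_const c) S = ext_coeff h S * (c::'a::comm_ring_1)"
proof (cases "finite S")
  case True
  have "ext_coeff (h * ext_const c) S = (\<Sum>T\<in>Pow S. if T = S then ext_coeff h S * c else 0)"
    by (simp add: times_exterior.rep_eq ext_const.rep_eq) (rule sum.cong, auto)
  then show ?thesis using True by simp
qed (simp add: ext_coeff_infinite)

lemma ext_const_commute: "h * ext_const (c::'a::comm_ring_1) = ext_const c * h"
  by (rule exterior_eqI) (simp add: ext_coeff_const_mult ext_coeff_mult_const)

lemma ext_const_mult: "ext_const (a * b :: 'a::comm_ring_1) = ext_const a * ext_const b"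
proof (rule exterior_eqI)
  fix S
  show "ext_coeff (ext_const (a * b)) S = ext_coeff (ext_const a * ext_const b) S"
    by (simp add: ext_coeff_const_mult) (simp add: ext_const.rep_eq)
qed

lemma ext_const_power: "ext_const ((a :: 'a::comm_ring_1) ^ k) = ext_const a ^ k"
  by (induction k) (simp_all add: ext_const_mult)

lemma ext_const_sum: "ext_const (sum f A :: 'a::comm_ring_1) = (\<Sum>x\<in>A. ext_const (f x))"
  by (induction A rule: infinite_finite_induct) (simp_all add: ext_const_add)

lemma ext_const_left_commute:
  "h * (ext_const (c::'a::comm_ring_1) * g) = ext_const c * (h * g)"
  by (metis ext_const_commute mult.assoc)

lemma ext_const_of_int: "ext_const (of_int k :: 'a::comm_ring_1) = of_int k"
proof (cases k)
  case (nonneg m)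
  have "ext_const (of_nat m :: 'a) = of_nat m" by (induction m) (simp_all add: ext_const_add)
  then show ?thesis using nonneg by simp
next
  case (neg m)
  have "ext_const (of_nat m :: 'a) = of_nat m" for m by (induction m) (simp_all add: ext_const_add)
  from this[of "Suc m"] show ?thesis using neg by (simp del: of_nat_Suc)
qed

section \<open>Ordered products\<close>

text \<open>The family is arbitrary, so that the generators, the dual basis and the images of
  generators under an algebra map share one calculus of signs.\<close>

definition ord_prod :: "(nat \<Rightarrow> 'a::ring_1) \<Rightarrow> nat set \<Rightarrow> 'a" where
  "ord_prod w S = prod_list (map w (sorted_list_of_set S))"

text \<open>The exponent in \<open>ext_sign\<close>, kept as a number so that the sign can be read
  in any ring.\<close>

definition inversions :: "nat set \<Rightarrow> nat set \<Rightarrow> nat" where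
  "inversions S T = card {(s, t). s \<in> S \<and> t \<in> T \<and> t < s}"

lemma ord_prod_empty [simp]: "ord_prod w {} = 1"
  by (simp add: ord_prod_def)

lemma ord_prod_insert_min:
  assumes "finite A" "\<forall>a\<in>A. b < a"
  shows "ord_prod w (insert b A) = w b * ord_prod w A"
proof -
  have "b \<notin> A" using assms by auto
  then have "sorted_list_of_set (insert b A) = b # sorted_list_of_set A"
    using assms by (simp add: insort_is_Cons less_imp_le)
  then show ?thesis by (simp add: ord_prod_def)
qed

lemma inversions_insert_min:
  assumes "finite A" "finite T" "\<forall>a\<in>A. b < a"
  shows "inversions (insert b A) T = inversions A T + card {t\<in>T. t < b}"
proof -
  have "{(s, t). s \<in> insert b A \<and> t \<in> T \<and> t < s} =
      {(s, t). s \<in> A \<and> t \<in> T \<and> t < s} \<union> Pair b ` {t\<in>T. t < b}" by auto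
  moreover have "card (Pair b ` {t\<in>T. t < b}) = card {t\<in>T. t < b}"
    by (rule card_image) (auto simp: inj_on_def)
  moreover have "{(s, t). s \<in> A \<and> t \<in> T \<and> t < s} \<inter> Pair b ` {t\<in>T. t < b} = {}"
    using assms by auto
  ultimately show ?thesis
    using assms by (simp add: inversions_def card_Un_disjoint finite_inversions)
qed

text \<open>Vanishing squares are a separate assumption: anticommutation alone gives only 2 w_s^2 =
  0.\<close>

locale anticommuting =
  fixes w :: "nat \<Rightarrow> 'a::ring_1"
  assumes anticomm: "w s * w t = - (w t * w s)"
    and square_zero: "w s * w s = 0"
begin

text \<open>Induction strips the smallest factor w_m: w_s either already stands in front of it,
  meets it and gives a square, or passes it at the cost of one sign.\<close>

lemma gen_mult_ord_prod:
  "finite T \<Longrightarrow> w s * ord_prod w T =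
    (if s \<in> T then 0 else (- 1) ^ card {t\<in>T. t < s} * ord_prod w (insert s T))"
proof (induction T rule: finite_linorder_min_induct)
  case empty
  then show ?case using ord_prod_insert_min[of "{}" s w] by simp
next
  case (insert m T)
  consider "s < m" | "s = m" | "m < s" by linarith
  then show ?case
  proof cases
    case 1
    then have *: "s \<notin> insert m T" "{t \<in> insert m T. t < s} = {}" "\<forall>a\<in>insert m T. s < a"
      using insert.hyps by force+
    then have "ord_prod w (insert s (insert m T)) = w s * ord_prod w (insert m T)"
      using insert.hyps by (intro ord_prod_insert_min) auto
    then show ?thesis unfolding *(2) using *(1) by simp
  next
    case 2
    then show ?thesis
      using insert.hyps by (simp add: ord_prod_insert_min mult.assoc[symmetric] square_zero)
  next
    case 3
    have "w s * ord_prod w (insert m T) = w s * w m * ord_prod w T"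
      using insert.hyps by (simp add: ord_prod_insert_min mult.assoc)
    also have "\<dots> = - (w m * (w s * ord_prod w T))"
      by (subst anticomm) (simp add: mult.assoc)
    also have "\<dots> = (if s \<in> insert m T then 0 else
        (- 1) ^ card {t \<in> insert m T. t < s} * ord_prod w (insert s (insert m T)))"
    proof (cases "s \<in> T")
      case True
      then show ?thesis using insert by simp
    next
      case False
      have "{t \<in> insert m T. t < s} = insert m {t \<in> T. t < s}" using 3 by auto
      moreover have "m \<notin> T" using insert.hyps by auto
      ultimately have c: "card {t \<in> insert m T. t < s} = Suc (card {t \<in> T. t < s})"
        using insert.hyps by simp
      have "ord_prod w (insert s (insert m T)) = w m * ord_prod w (insert s T)"
        using insert.hyps 3 by (subst insert_commute) (rule ord_prod_insert_min, auto)
      moreover have "w m * (- 1) ^ k = (- 1) ^ k * w m" for k :: nat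
        by (induction k) (auto simp: algebra_simps)
      ultimately show ?thesis
        using False 3 insert.IH unfolding c by (simp add: mult.assoc[symmetric])
    qed
    finally show ?thesis .
  qed
qed

text \<open>The smallest m in S is multiplied last from the left. As all of S exceeds m, the only
  factors it passes come from T, and these are the inversions that m adds.\<close>

lemma ord_prod_mult:
  assumes "finite S" "finite T"
  shows "ord_prod w S * ord_prod w T =
    (if S \<inter> T = {} then (- 1) ^ inversions S T * ord_prod w (S \<union> T) else 0)"
  using assms(1)
proof (induction S rule: finite_linorder_min_induct)
  case empty
  then show ?case by (simp add: inversions_def)
next
  case (insert m S)
  have *: "ord_prod w (insert m S) * ord_prod w T = w m * (ord_prod w S * ord_prod w T)"
    using insert.hyps by (simp add: ord_prod_insert_min mult.assoc)
  show ?case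
  proof (cases "S \<inter> T = {}")
    case True
    have m: "w m * (- 1) ^ k = (- 1) ^ k * w m" for k :: nat
      by (induction k) (auto simp: algebra_simps)
    have "{t \<in> S \<union> T. t < m} = {t \<in> T. t < m}" "m \<notin> S" using insert.hyps by force+
    then have "w m * ord_prod w (S \<union> T) = (if m \<in> T then 0 else
        (- 1) ^ card {t \<in> T. t < m} * ord_prod w (insert m (S \<union> T)))"
      using gen_mult_ord_prod[of "S \<union> T" m] insert.hyps assms by simp
    then have "w m * ((- 1) ^ inversions S T * ord_prod w (S \<union> T)) = (if m \<in> T then 0 else
        (- 1) ^ inversions (insert m S) T * ord_prod w (insert m (S \<union> T)))"
      using insert.hyps assms(2)
      by (simp add: inversions_insert_min mult.assoc[symmetric] m)
        (simp add: mult.assoc power_add)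
    then show ?thesis using True insert.IH * by auto
  next
    case False
    then show ?thesis using * insert.IH by auto
  qed
qed

end

section \<open>Generators and monomials of the exterior algebra\<close>

lemma ext_coeff_gen_mult:
  "ext_coeff (ext_gen i * h) S =
    (if finite S \<and> i \<in> S then ext_sign {i} (S - {i}) * ext_coeff h (S - {i}) else (0::'a::comm_ring_1))"
proof (cases "finite S")
  case True
  have "ext_coeff (ext_gen i * h) S =
      (\<Sum>T\<in>Pow S. if T = {i} then ext_sign {i} (S - {i}) * ext_coeff h (S - {i}) else 0)"
    by (simp add: times_exterior.rep_eq ext_gen.rep_eq) (rule sum.cong, auto)
  then show ?thesis using True by simp
qed (simp add: ext_coeff_infinite)

lemma ext_coeff_gen: "ext_coeff (ext_gen i) S = (if S = {i} then 1 else 0)"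
  by (simp add: ext_gen.rep_eq)

lemma anticommuting_ext_gen: "anticommuting (ext_gen :: nat \<Rightarrow> 'a::comm_ring_1 exterior)"
proof
  fix s t
  have inv: "{(u, v). u = a \<and> v = b \<and> v < u} = (if b < a then {(a, b)} else {})" for a b :: nat
    by auto
  have sgn: "(ext_sign {a} {b} :: 'a) = (if b < a then - 1 else 1)" for a b :: nat
    by (simp add: ext_sign_def inv)
  have set: "i \<in> S \<and> S - {i} = {j} \<longleftrightarrow> i \<noteq> j \<and> S = {i, j}" for i j :: nat and S
    by auto
  have prod: "ext_coeff (ext_gen i * ext_gen j) S =
      (if i \<noteq> j \<and> S = {i, j} then ext_sign {i} {j} else (0::'a))" for i j S
    using set[of i S j] by (cases "finite S") (auto simp: ext_coeff_gen_mult ext_coeff_gen)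
  show "(ext_gen s * ext_gen t :: 'a exterior) = - (ext_gen t * ext_gen s)"
    by (rule exterior_eqI) (auto simp: prod uminus_exterior.rep_eq sgn insert_commute)
  show "(ext_gen s * ext_gen s :: 'a exterior) = 0"
    by (rule exterior_eqI) (auto simp: prod zero_exterior.rep_eq)
qed

lemma ext_coeff_monomial:
  "finite S \<Longrightarrow> ext_coeff (ord_prod ext_gen S) T = (if T = S then 1 else (0::'a::comm_ring_1))"
proof (induction S arbitrary: T rule: finite_linorder_min_induct)
  case empty
  then show ?case by (auto simp: one_exterior.rep_eq)
next
  case (insert m S)
  have "m \<notin> S" using insert.hyps by auto
  then have *: "finite T \<and> m \<in> T \<and> T - {m} = S \<longleftrightarrow> T = insert m S" using insert.hyps by auto
  have "{(s, t). s = m \<and> t \<in> S \<and> t < s} = {}" using insert.hyps by force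
  then have "(ext_sign {m} S :: 'a) = 1" by (simp only: ext_sign_def singleton_iff card.empty) simp
  then show ?case
    using * insert.hyps insert.IH
    by (auto simp: ord_prod_insert_min ext_coeff_gen_mult)
qed

section \<open>Homomorphisms of exterior algebras\<close>

text \<open>The map given by the universal property of the exterior algebra: \<open>\<psi>\<close>
  on coefficients and e_s to \<open>w s\<close>. Allowing a nontrivial \<open>\<psi>\<close> covers
  the GL_n action as well as changes of basis.\<close>

definition ext_map :: "('a::comm_ring_1 \<Rightarrow> 'b::comm_ring_1) \<Rightarrow> (nat \<Rightarrow> 'b exterior) \<Rightarrow>
    'a exterior \<Rightarrow> 'b exterior" where
  "ext_map \<psi> w h = (\<Sum>S | ext_coeff h S \<noteq> 0. ext_const (\<psi> (ext_coeff h S)) * ord_prod w S)"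

locale ext_hom = comm_ring_hom \<psi> + anticommuting w
  for \<psi> :: "'a::comm_ring_1 \<Rightarrow> 'b::comm_ring_1" and w :: "nat \<Rightarrow> 'b exterior"
begin

text \<open>Lets the expansions of g, h and g + h run over one common index set.\<close>

lemma ext_map_superset:
  assumes "finite X" "{S. ext_coeff h S \<noteq> 0} \<subseteq> X"
  shows "ext_map \<psi> w h = (\<Sum>S\<in>X. ext_const (\<psi> (ext_coeff h S)) * ord_prod w S)"
  unfolding ext_map_def by (rule sum.mono_neutral_left) (use assms in auto)

lemma ext_map_add: "ext_map \<psi> w (g + h) = ext_map \<psi> w g + ext_map \<psi> w h"
proof -
  let ?X = "{S. ext_coeff g S \<noteq> 0} \<union> {S. ext_coeff h S \<noteq> 0}"
  have X: "finite ?X" by (simp add: finite_ext_supp)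
  have "{S. ext_coeff (g + h) S \<noteq> 0} \<subseteq> ?X" by (auto simp: plus_exterior.rep_eq)
  then show ?thesis
    using X by (subst (1 2 3) ext_map_superset[of ?X])
      (auto simp: plus_exterior.rep_eq hom_add ext_const_add distrib_right sum.distrib)
qed

lemma ext_map_0 [simp]: "ext_map \<psi> w 0 = 0"
  by (simp add: ext_map_def zero_exterior.rep_eq)

lemma ext_map_sum: "ext_map \<psi> w (sum f A) = (\<Sum>x\<in>A. ext_map \<psi> w (f x))"
  by (induction A rule: infinite_finite_induct) (auto simp: ext_map_add)

lemma ext_map_monomial:
  assumes "finite S"
  shows "ext_map \<psi> w (ext_const c * ord_prod ext_gen S) = ext_const (\<psi> c) * ord_prod w S"
proof -
  have "{T. ext_coeff (ext_const c * ord_prod ext_gen S) T \<noteq> 0} \<subseteq> {S}"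
    using assms by (auto simp: ext_coeff_const_mult ext_coeff_monomial split: if_splits)
  then show ?thesis
    using assms by (subst ext_map_superset[of "{S}"])
      (auto simp: ext_coeff_const_mult ext_coeff_monomial)
qed

lemma ext_map_const [simp]: "ext_map \<psi> w (ext_const c) = ext_const (\<psi> c)"
  using ext_map_monomial[of "{}" c] by simp

lemma ext_map_gen [simp]: "ext_map \<psi> w (ext_gen s) = w s"
  using ext_map_monomial[of "{s}" 1] by (simp add: ord_prod_def)

end

lemma ext_expand:
  "(\<Sum>S | ext_coeff h S \<noteq> 0. ext_const (ext_coeff h S) * ord_prod ext_gen S) = h"
proof (rule exterior_eqI)
  fix T :: "nat set"
  have fin: "finite S" if "ext_coeff h S \<noteq> 0" for S
    using that ext_coeff_infinite by blast
  have "ext_coeff (\<Sum>S | ext_coeff h S \<noteq> 0. ext_const (ext_coeff h S) * ord_prod ext_gen S) T =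
      (\<Sum>S | ext_coeff h S \<noteq> 0. if T = S then ext_coeff h S else 0)"
    by (simp add: ext_coeff_sum ext_coeff_const_mult)
      (rule sum.cong, auto simp: ext_coeff_monomial fin)
  also have "\<dots> = ext_coeff h T" by (simp add: finite_ext_supp)
  finally show "ext_coeff (\<Sum>S | ext_coeff h S \<noteq> 0. ext_const (ext_coeff h S) * ord_prod ext_gen S) T =
    ext_coeff h T" .
qed

lemma ext_induct [case_names add monomial]:
  assumes "\<And>g h. P g \<Longrightarrow> P h \<Longrightarrow> P (g + h)"
    and "\<And>c S. finite S \<Longrightarrow> P (ext_const c * ord_prod ext_gen S)"
  shows "P h"
proof -
  have 0: "P 0" using assms(2)[of "{}" 0] by simp
  have "P (\<Sum>S\<in>X. ext_const (ext_coeff h S) * ord_prod ext_gen S)"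
    if "X \<subseteq> {S. ext_coeff h S \<noteq> 0}" "finite X" for X
    using that(2,1)
  proof (induction X rule: finite_induct)
    case (insert S X)
    moreover have "finite S" using insert.prems ext_coeff_infinite by blast
    ultimately show ?case using assms by simp
  qed (simp add: 0)
  from this[OF subset_refl finite_ext_supp] show ?thesis by (simp add: ext_expand)
qed

context ext_hom
begin

text \<open>Both sides are biadditive, so monomials suffice. There \<open>ord_prod_mult\<close>
  produces the same inversion sign for the generators as for their images.\<close>

lemma ext_map_mult: "ext_map \<psi> w (g * h) = ext_map \<psi> w g * ext_map \<psi> w h"
proof (induction g rule: ext_induct)
  case (add g g')
  then show ?case by (simp add: distrib_right ext_map_add)
next
  case (monomial a S)
  note S = this
  show ?case
  proof (induction h rule: ext_induct)
    case (add g g')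
    then show ?case by (simp add: distrib_left ext_map_add)
  next
    case (monomial b T)
    interpret e: anticommuting "ext_gen :: nat \<Rightarrow> 'a exterior" by (rule anticommuting_ext_gen)
    have sgn: "((- 1) ^ k :: 'c::comm_ring_1 exterior) = ext_const ((- 1) ^ k)" for k
      by (simp add: ext_const_power)
    have "ext_const a * ord_prod ext_gen S * (ext_const b * ord_prod ext_gen T) =
        ext_const (a * b) * (ord_prod ext_gen S * ord_prod ext_gen T)"
      by (simp add: mult.assoc ext_const_mult ext_const_left_commute[of "ord_prod _ _"])
    also have "\<dots> = (if S \<inter> T = {}
        then ext_const (a * b * (- 1) ^ inversions S T) * ord_prod ext_gen (S \<union> T) else 0)"
      using S monomial by (simp add: e.ord_prod_mult sgn mult.assoc ext_const_mult)
    finally have "ext_map \<psi> w (ext_const a * ord_prod ext_gen S * (ext_const b * ord_prod ext_gen T)) =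
        (if S \<inter> T = {} then ext_const (\<psi> a * \<psi> b * (- 1) ^ inversions S T) * ord_prod w (S \<union> T) else 0)"
      using S monomial by (simp add: ext_map_monomial hom_distribs)
    also have "\<dots> = ext_const (\<psi> a * \<psi> b) * (ord_prod w S * ord_prod w T)"
      using S monomial by (simp add: ord_prod_mult sgn mult.assoc ext_const_mult)
    also have "\<dots> = ext_const (\<psi> a) * ord_prod w S * (ext_const (\<psi> b) * ord_prod w T)"
      by (simp add: mult.assoc ext_const_mult ext_const_left_commute[of "ord_prod _ _"])
    finally show ?case using S monomial by (simp add: ext_map_monomial)
  qed
qed

lemma ext_map_1 [simp]: "ext_map \<psi> w 1 = 1"
  using ext_map_const[of 1] by simp

lemma ring_hom_ext_map: "Ring_Hom.ring_hom (ext_map \<psi> w)"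
  by standard (simp_all add: ext_map_add ext_map_mult)

end

section \<open>Determinants with anticommuting entries\<close>

text \<open>Choice functions are normalized to the identity off the list. This makes each choice
  count once and puts the permutations of the index set among the choices.\<close>

lemma prod_list_sum_distrib:
  fixes g :: "'i \<Rightarrow> 'i \<Rightarrow> 'a::ring_1"
  assumes "distinct xs"
  shows "prod_list (map (\<lambda>i. \<Sum>k\<in>A. g i k) xs) =
    (\<Sum>\<phi> | (\<forall>i\<in>set xs. \<phi> i \<in> A) \<and> (\<forall>i. i \<notin> set xs \<longrightarrow> \<phi> i = i).
      prod_list (map (\<lambda>i. g i (\<phi> i)) xs))"
  using assms
proof (induction xs)
  case Nil
  have "{\<phi> :: 'i \<Rightarrow> 'i. \<forall>i. \<phi> i = i} = {id}" by auto
  then show ?case by simp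
next
  case (Cons x xs)
  let ?F = "\<lambda>xs. {\<phi>. (\<forall>i\<in>set xs. \<phi> i \<in> A) \<and> (\<forall>i. i \<notin> set xs \<longrightarrow> \<phi> i = i)}"
  have "prod_list (map (\<lambda>i. \<Sum>k\<in>A. g i k) (x # xs)) =
      (\<Sum>(k, \<phi>)\<in>A \<times> ?F xs. g x k * prod_list (map (\<lambda>i. g i (\<phi> i)) xs))"
    using Cons by (simp add: sum_product sum.cartesian_product)
  also have "\<dots> = (\<Sum>\<phi>\<in>?F (x # xs). prod_list (map (\<lambda>i. g i (\<phi> i)) (x # xs)))"
  proof (rule sum.reindex_bij_witness[of _ "\<lambda>\<phi>. (\<phi> x, \<phi>(x := x))" "\<lambda>(k, \<phi>). \<phi>(x := k)"])
    fix \<phi> assume "\<phi> \<in> ?F (x # xs)"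
    then show "(\<phi> x, \<phi>(x := x)) \<in> A \<times> ?F xs" using Cons.prems by auto
  next
    fix a assume a: "a \<in> A \<times> ?F xs"
    then obtain k \<phi> where k: "a = (k, \<phi>)" "k \<in> A" "\<phi> \<in> ?F xs" by auto
    have eq: "map (\<lambda>i. g i ((\<phi>(x := k)) i)) xs = map (\<lambda>i. g i (\<phi> i)) xs"
      using Cons.prems by auto
    show "prod_list (map (\<lambda>i. g i ((case a of (k, \<phi>) \<Rightarrow> \<phi>(x := k)) i)) (x # xs)) =
        (case a of (k, \<phi>) \<Rightarrow> g x k * prod_list (map (\<lambda>i. g i (\<phi> i)) xs))"
      unfolding k(1) prod.case list.map prod_list.Cons eq by simp
  qed (use Cons.prems in auto)
  finally show ?case .
qed

lemma prod_list_mult_const: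
  "prod_list (map (\<lambda>i. B i * ext_const (d i :: 'a::comm_ring_1)) xs) =
    prod_list (map B xs) * ext_const (prod_list (map d xs))"
proof (induction xs)
  case (Cons x xs)
  then show ?case
    by (simp add: ext_const_mult mult.assoc ext_const_left_commute[of "prod_list _"])
qed simp

text \<open>A non-injective choice repeats a row; an injective choice on a finite set is a
  permutation.\<close>

lemma det_select_rows:
  fixes c :: "nat \<Rightarrow> nat \<Rightarrow> 'a::comm_ring_1"
  assumes "\<forall>i\<in>{0..<n}. \<phi> i \<in> {0..<n}" "\<forall>i. i \<notin> {0..<n} \<longrightarrow> \<phi> i = i"
  shows "det (mat n n (\<lambda>(i, j). c (\<phi> i) j)) =
    (if \<phi> permutes {0..<n} then of_int (sign \<phi>) * det (mat n n (\<lambda>(i, j). c i j)) else 0)"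
proof (cases "inj_on \<phi> {0..<n}")
  case True
  then have "\<phi> ` {0..<n} = {0..<n}" using assms(1) by (intro endo_inj_surj) auto
  then have p: "\<phi> permutes {0..<n}"
    using True assms(2) by (intro bij_imp_permutes) (auto simp: bij_betw_def)
  have "mat n n (\<lambda>(i, j). c (\<phi> i) j) =
      mat n n (\<lambda>(i, j). mat n n (\<lambda>(i, j). c i j) $$ (\<phi> i, j))"
    using assms(1) by (intro eq_matI) auto
  then show ?thesis
    using p det_permute_rows[of "mat n n (\<lambda>(i, j). c i j)" n \<phi>] by simp
next
  case False
  then obtain i j where ij: "i < n" "j < n" "i \<noteq> j" "\<phi> i = \<phi> j"
    by (auto simp: inj_on_def)
  have "det (mat n n (\<lambda>(i, j). c (\<phi> i) j)) = 0"
    by (rule det_identical_rows[of _ n i j]) (use ij in auto)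
  moreover have "\<not> \<phi> permutes {0..<n}"
    using ij permutes_inj by (metis injD)
  ultimately show ?thesis by simp
qed

text \<open>The usual proof that determinants multiply survives without commutativity of the entries
  of \<open>B\<close>: the scalars are central and move to the right, while the entries of
  \<open>B\<close> keep their row order. For each choice of column indices the scalars then sum to a
  determinant with selected rows.\<close>

lemma row_det_mult:
  fixes c :: "nat \<Rightarrow> nat \<Rightarrow> 'a::comm_ring_1"
  shows "row_det n (\<lambda>i j. \<Sum>k = 0..<n. B i k * ext_const (c k j)) =
    row_det n B * ext_const (det (mat n n (\<lambda>(i, j). c i j)))"
proof -
  let ?P = "{\<pi>. \<pi> permutes {0..<n}}"
  let ?F = "{\<phi>. (\<forall>i\<in>{0..<n}. \<phi> i \<in> {0..<n}) \<and> (\<forall>i. i \<notin> {0..<n} \<longrightarrow> \<phi> i = i)}"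
  let ?B = "\<lambda>\<phi>. prod_list (map (\<lambda>i. B i (\<phi> i)) [0..<n])"
  have fin: "finite ?F" by (rule finite_bounded_functions) auto
  have list: "prod_list (map d [0..<n]) = (\<Prod>i = 0..<n. d i)" for d :: "nat \<Rightarrow> 'a"
    using prod.distinct_set_conv_list[of "[0..<n]" d] by simp
  have "row_det n (\<lambda>i j. \<Sum>k = 0..<n. B i k * ext_const (c k j)) =
      (\<Sum>\<pi>\<in>?P. of_int (sign \<pi>) * (\<Sum>\<phi>\<in>?F. ?B \<phi> * ext_const (\<Prod>i = 0..<n. c (\<phi> i) (\<pi> i))))"
    unfolding row_det_def by (subst prod_list_sum_distrib) (simp_all add: prod_list_mult_const list)
  also have "\<dots> = (\<Sum>\<pi>\<in>?P. \<Sum>\<phi>\<in>?F.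
      ?B \<phi> * ext_const (of_int (sign \<pi>) * (\<Prod>i = 0..<n. c (\<phi> i) (\<pi> i))))"
    by (simp add: sum_distrib_left ext_const_mult ext_const_of_int[symmetric]
      ext_const_left_commute[of "prod_list _"])
  also have "\<dots> = (\<Sum>\<phi>\<in>?F. ?B \<phi> * ext_const (det (mat n n (\<lambda>(i, j). c (\<phi> i) j))))"
  proof (subst sum.swap, rule sum.cong[OF refl])
    fix \<phi> assume \<phi>: "\<phi> \<in> ?F"
    have "det (mat n n (\<lambda>(i, j). c (\<phi> i) j)) =
        (\<Sum>\<pi>\<in>?P. of_int (sign \<pi>) * (\<Prod>i = 0..<n. c (\<phi> i) (\<pi> i)))"
      by (subst det_def'[of _ n]) (auto intro!: sum.cong prod.cong simp: permutes_in_image)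
    then show "(\<Sum>\<pi>\<in>?P. ?B \<phi> * ext_const (of_int (sign \<pi>) * (\<Prod>i = 0..<n. c (\<phi> i) (\<pi> i)))) =
        ?B \<phi> * ext_const (det (mat n n (\<lambda>(i, j). c (\<phi> i) j)))"
      by (simp add: ext_const_sum sum_distrib_left)
  qed
  also have "\<dots> = (\<Sum>\<phi>\<in>?P. ?B \<phi> * ext_const (of_int (sign \<phi>) * det (mat n n (\<lambda>(i, j). c i j))))"
  proof (rule sum.mono_neutral_cong_right[OF fin])
    show sub: "?P \<subseteq> ?F" by (auto simp: permutes_in_image permutes_not_in)
    have sel: "det (mat n n (\<lambda>(i, j). c (\<phi> i) j)) =
        (if \<phi> permutes {0..<n} then of_int (sign \<phi>) * det (mat n n (\<lambda>(i, j). c i j)) else 0)"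
      if "\<phi> \<in> ?F" for \<phi>
      using that by (intro det_select_rows) simp_all
    show "\<forall>\<phi>\<in>?F - ?P. ?B \<phi> * ext_const (det (mat n n (\<lambda>(i, j). c (\<phi> i) j))) = 0"
      by (auto simp: sel)
    show "?B \<phi> * ext_const (det (mat n n (\<lambda>(i, j). c (\<phi> i) j))) =
        ?B \<phi> * ext_const (of_int (sign \<phi>) * det (mat n n (\<lambda>(i, j). c i j)))"
      if "\<phi> \<in> ?P" for \<phi>
      using that sub by (subst sel) auto
  qed
  also have "\<dots> = row_det n B * ext_const (det (mat n n (\<lambda>(i, j). c i j)))"
  proof -
    have "?B \<phi> * ext_const (of_int (sign \<phi>) * det (mat n n (\<lambda>(i, j). c i j))) =
        of_int (sign \<phi>) * ?B \<phi> * ext_const (det (mat n n (\<lambda>(i, j). c i j)))" for \<phi>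
      by (simp only: ext_const_mult ext_const_left_commute[of "prod_list _"])
        (simp add: ext_const_of_int mult.assoc)
    then show ?thesis by (simp add: row_det_def sum_distrib_right)
  qed
  finally show ?thesis .
qed

lemma row_det_cong:
  "(\<And>i j. i < n \<Longrightarrow> j < n \<Longrightarrow> a i j = b i j) \<Longrightarrow> row_det n a = row_det n b"
  unfolding row_det_def
  by (intro sum.cong arg_cong2[of _ _ _ _ "(*)"] refl arg_cong[of _ _ prod_list] map_cong)
    (auto simp: permutes_in_image)

lemma (in ring_hom) hom_row_det: "hom (row_det n a) = row_det n (\<lambda>i j. hom (a i j))"
proof -
  have "hom (prod_list (map f xs)) = prod_list (map (\<lambda>x. hom (f x)) xs)" for f :: "nat \<Rightarrow> 'a" and xs
    by (induction xs) (auto simp: hom_mult)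
  then show ?thesis by (simp add: row_det_def hom_sum hom_mult)
qed

text \<open>An identity row i forces the permutation to fix i, so only permutations of the first k
  indices contribute.\<close>

lemma row_det_lower_identity:
  fixes g :: "nat \<Rightarrow> 'a::ring_1"
  assumes "k \<le> n"
  shows "row_det n (\<lambda>i j. if i < k then g j else if i = j then 1 else 0) =
    (\<Sum>\<pi> | \<pi> permutes {0..<k}. of_int (sign \<pi>) * prod_list (map (\<lambda>i. g (\<pi> i)) [0..<k]))"
proof -
  let ?a = "\<lambda>i j. if i < k then g j else if i = j then 1 else 0"
  have split: "[0..<n] = [0..<k] @ [k..<n]"
    using assms by (metis le_add_diff_inverse upt_add_eq_append zero_le)
  have one: "prod_list (map (\<lambda>i. if i = \<pi> i then 1 else 0) [k..<n]) =
      (if \<forall>i\<in>{k..<n}. \<pi> i = i then 1 else (0 :: 'a))" for \<pi> :: "nat \<Rightarrow> nat"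
  proof -
    have "prod_list (map (\<lambda>i. if i = \<pi> i then 1 else 0) xs) =
        (if \<forall>i\<in>set xs. \<pi> i = i then 1 else (0 :: 'a))" for xs
      by (induction xs) auto
    from this[of "[k..<n]"] show ?thesis by simp
  qed
  have prod: "prod_list (map (\<lambda>i. ?a i (\<pi> i)) [0..<n]) =
      (if \<forall>i\<in>{k..<n}. \<pi> i = i then prod_list (map (\<lambda>i. g (\<pi> i)) [0..<k]) else 0)" for \<pi>
  proof -
    have "map (\<lambda>i. ?a i (\<pi> i)) [0..<k] = map (\<lambda>i. g (\<pi> i)) [0..<k]"
      "map (\<lambda>i. ?a i (\<pi> i)) [k..<n] = map (\<lambda>i. if i = \<pi> i then 1 else 0) [k..<n]" by auto
    then show ?thesis by (simp only: split map_append prod_list.append one) simp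
  qed
  have perm: "\<pi> permutes {0..<n} \<and> (\<forall>i\<in>{k..<n}. \<pi> i = i) \<longleftrightarrow> \<pi> permutes {0..<k}" for \<pi>
  proof
    assume "\<pi> permutes {0..<n} \<and> (\<forall>i\<in>{k..<n}. \<pi> i = i)"
    then show "\<pi> permutes {0..<k}" using permutes_superset[of \<pi> "{0..<n}" "{0..<k}"] by simp
  next
    assume p: "\<pi> permutes {0..<k}"
    then have "\<pi> permutes {0..<n}" by (rule permutes_subset) (use assms in auto)
    then show "\<pi> permutes {0..<n} \<and> (\<forall>i\<in>{k..<n}. \<pi> i = i)"
      using permutes_not_in[OF p] by simp
  qed
  have "row_det n ?a = (\<Sum>\<pi> | \<pi> permutes {0..<n}. if \<forall>i\<in>{k..<n}. \<pi> i = i then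
      of_int (sign \<pi>) * prod_list (map (\<lambda>i. g (\<pi> i)) [0..<k]) else 0)"
    unfolding row_det_def prod by (intro sum.cong) auto
  also have "\<dots> = (\<Sum>\<pi> | \<pi> permutes {0..<k}. of_int (sign \<pi>) * prod_list (map (\<lambda>i. g (\<pi> i)) [0..<k]))"
    by (subst sum.inter_filter[symmetric]) (simp_all add: finite_permutations perm)
  finally show ?thesis .
qed

section \<open>Substitution homomorphisms of the polynomial ring\<close>

text \<open>Same shape as \<open>gl_poly\<close>, with arbitrary polynomials in place of linear
  forms; this also allows variables to be set to 0.\<close>

definition psubst :: "(nat \<Rightarrow> 'p fpoly) \<Rightarrow> 'p::prime_card fpoly \<Rightarrow> 'p fpoly" where
  "psubst \<sigma> f = (\<Sum>m\<in>Poly_Mapping.keys f. PC (Poly_Mapping.lookup f m) *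
     (\<Prod>s\<in>Poly_Mapping.keys m. \<sigma> s ^ Poly_Mapping.lookup m s))"

lemma PC_0 [simp]: "PC 0 = 0"
  by (simp add: PC_def)

declare PC_1 [simp]

lemma psubst_superset:
  assumes "finite X" "Poly_Mapping.keys f \<subseteq> X"
  shows "psubst \<sigma> f = (\<Sum>m\<in>X. PC (Poly_Mapping.lookup f m) *
     (\<Prod>s\<in>Poly_Mapping.keys m. \<sigma> s ^ Poly_Mapping.lookup m s))"
  unfolding psubst_def by (rule sum.mono_neutral_left) (use assms in \<open>auto simp: in_keys_iff\<close>)

lemma psubst_add: "psubst \<sigma> (f + g) = psubst \<sigma> f + psubst \<sigma> g"
proof -
  have "Poly_Mapping.keys (f + g) \<subseteq> Poly_Mapping.keys f \<union> Poly_Mapping.keys g"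
    by (rule keys_add)
  then show ?thesis
    by (subst (1 2 3) psubst_superset[of "Poly_Mapping.keys f \<union> Poly_Mapping.keys g"])
      (auto simp: lookup_add PC_add distrib_right sum.distrib)
qed

lemma psubst_single:
  "psubst \<sigma> (Poly_Mapping.single m c) =
    PC c * (\<Prod>s\<in>Poly_Mapping.keys m. \<sigma> s ^ Poly_Mapping.lookup m s)"
  by (subst psubst_superset[of "{m}"]) auto

lemma poly_mapping_induct_single [case_names add single]:
  fixes f :: "'a \<Rightarrow>\<^sub>0 'b::comm_monoid_add"
  assumes "\<And>f g. P f \<Longrightarrow> P g \<Longrightarrow> P (f + g)" and "\<And>m c. P (Poly_Mapping.single m c)"
  shows "P f"
proof (induction f rule: update_induct)
  case const
  show ?case using assms(2)[of undefined 0] by simp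
next
  case (update f a b)
  have "Poly_Mapping.update a b f = f + Poly_Mapping.single a b"
    using update by (intro poly_mapping_eqI) (auto simp: lookup_update lookup_add lookup_single in_keys_iff when_def)
  then show ?case using update assms by simp
qed

lemma psubst_mult: "psubst \<sigma> (f * g) = psubst \<sigma> f * psubst \<sigma> g"
proof (induction f rule: poly_mapping_induct_single)
  case (add f f')
  then show ?case by (simp add: distrib_right psubst_add)
next
  case (single m c)
  show ?case
  proof (induction g rule: poly_mapping_induct_single)
    case (add g g')
    then show ?case by (simp add: distrib_left psubst_add)
  next
    case (single m' c')
    \<comment> \<open>Indices outside the support have exponent 0 and contribute the factor 1, so
      all three monomials can be written over this common set.\<close>
    let ?X = "Poly_Mapping.keys m \<union> Poly_Mapping.keys m'"
    have X: "(\<Prod>s\<in>Poly_Mapping.keys k. \<sigma> s ^ Poly_Mapping.lookup k s) =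
        (\<Prod>s\<in>?X. \<sigma> s ^ Poly_Mapping.lookup k s)" if "Poly_Mapping.keys k \<subseteq> ?X" for k
      by (rule prod.mono_neutral_left) (use that in \<open>auto simp: in_keys_iff\<close>)
    have "(\<Prod>s\<in>?X. \<sigma> s ^ Poly_Mapping.lookup (m + m') s) =
        (\<Prod>s\<in>?X. \<sigma> s ^ Poly_Mapping.lookup m s) * (\<Prod>s\<in>?X. \<sigma> s ^ Poly_Mapping.lookup m' s)"
      by (simp add: lookup_add power_add prod.distrib)
    moreover have "psubst \<sigma> (Poly_Mapping.single m c * Poly_Mapping.single m' c') =
        PC c * PC c' * (\<Prod>s\<in>?X. \<sigma> s ^ Poly_Mapping.lookup (m + m') s)"
      by (simp add: mult_single psubst_single PC_mult X[of "m + m'", OF keys_add])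
    moreover have "psubst \<sigma> (Poly_Mapping.single m c) = PC c * (\<Prod>s\<in>?X. \<sigma> s ^ Poly_Mapping.lookup m s)"
      "psubst \<sigma> (Poly_Mapping.single m' c') = PC c' * (\<Prod>s\<in>?X. \<sigma> s ^ Poly_Mapping.lookup m' s)"
      by (simp_all add: psubst_single X)
    ultimately show ?case by (simp only: mult_ac)
  qed
qed

lemma psubst_PC [simp]: "psubst \<sigma> (PC c) = PC c"
  unfolding PC_def[of c] psubst_single by (simp add: PC_def)

lemma psubst_PX [simp]: "psubst \<sigma> (PX i) = \<sigma> i"
  by (simp add: PX_def psubst_single)

lemma comm_ring_hom_psubst: "comm_ring_hom (psubst \<sigma>)"
proof
  show "psubst \<sigma> 0 = 0" using psubst_PC[of \<sigma> 0] by simp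
  show "psubst \<sigma> 1 = 1" using psubst_PC[of \<sigma> 1] by simp
qed (simp_all add: psubst_add psubst_mult)

interpretation psubst: comm_ring_hom "psubst \<sigma>"
  by (rule comm_ring_hom_psubst)

lemma comm_ring_hom_PC: "comm_ring_hom PC"
  by standard (simp_all add: PC_add PC_mult)

interpretation PC: comm_ring_hom PC
  by (rule comm_ring_hom_PC)

section \<open>Frobenius\<close>

lemma single_eq_0_iff [simp]: "Poly_Mapping.single k c = 0 \<longleftrightarrow> c = 0"
  by (metis lookup_single_eq lookup_zero single_zero)

lemma PC_eq_0_iff [simp]: "PC c = 0 \<longleftrightarrow> c = 0"
  by (simp add: PC_def)

lemma CHAR_fpoly [simp]: "CHAR('p::prime_card fpoly) = CARD('p)"
proof (rule CHAR_eq_posI)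
  have *: "(of_nat k :: 'p fpoly) = PC (of_nat k)" for k by (simp add: PC_def)
  show "of_nat CARD('p) = (0 :: 'p fpoly)" unfolding * by simp
  show "of_nat k \<noteq> (0 :: 'p fpoly)" if "k > 0" "k < CARD('p)" for k
    unfolding * using of_nat_0_mod_ring_dvd[where 'a = 'p, of k] that nat_dvd_not_less[of k "CARD('p)"]
    by auto
qed auto

lemma prime_CHAR_fpoly: "prime CHAR('p::prime_card fpoly)"
  by (simp add: prime_card)

lemma frob_sum: "sum f A ^ (CARD('p) ^ r) = (\<Sum>i\<in>A. (f i :: 'p::prime_card fpoly) ^ (CARD('p) ^ r))"
  by (rule freshmans_dream_sum'[OF prime_CHAR_fpoly]) simp

lemma comm_ring_hom_frob: "comm_ring_hom (\<lambda>x :: 'p::prime_card fpoly. x ^ CARD('p))"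
proof
  fix x y :: "'p fpoly"
  show "(x + y) ^ CARD('p) = x ^ CARD('p) + y ^ CARD('p)"
    by (rule freshmans_dream[OF prime_CHAR_fpoly]) simp
qed (simp_all add: power_mult_distrib)

text \<open>Fermat's little theorem. It makes the p^r-th power of a linear form the same linear form
  in the powers x_k^(p^r).\<close>

lemma PC_power_card [simp]: "PC c ^ (CARD('p::prime_card) ^ r) = PC (c :: 'p mod_ring)"
  using finite_field_power_card_power_eq_same[of "CARD('p) ^ r" r c] by (simp flip: PC.hom_power)

lemma CARD_gt_1: "CARD('p::prime_card) > 1"
  using prime_card[where 'a = 'p] by (rule prime_gt_1_nat)

lemma PX_neq_0 [simp]: "PX i \<noteq> 0"
  by (simp add: PX_def)

section \<open>Dickson polynomials\<close>

text \<open>\<open>\<Sum>\<^sub>i dickson n i X^(p^i)\<close> is the monic additive polynomial whose roots are the linear forms in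
  the first \<open>n\<close> variables. The recursion uses that the polynomial for \<open>n + 1\<close> is
  \<open>D^p - D(x\<^sub>n)^(p-1) D\<close>, where \<open>D\<close> is the one for \<open>n\<close>.\<close>

fun dickson :: "nat \<Rightarrow> nat \<Rightarrow> 'p::prime_card fpoly" where
  "dickson 0 i = (if i = 0 then 1 else 0)"
| "dickson (Suc n) i = (if i = 0 then 0 else dickson n (i - 1) ^ CARD('p)) -
     (\<Sum>k\<le>n. dickson n k * PX n ^ (CARD('p) ^ k)) ^ (CARD('p) - 1) * dickson n i"

definition dickson_eval :: "nat \<Rightarrow> 'p::prime_card fpoly \<Rightarrow> 'p fpoly" where
  "dickson_eval n y = (\<Sum>k\<le>n. dickson n k * y ^ (CARD('p) ^ k))"

lemma dickson_Suc:
  "dickson (Suc n) i = (if i = 0 then 0 else dickson n (i - 1) ^ CARD('p)) -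
     dickson_eval n (PX n) ^ (CARD('p::prime_card) - 1) * (dickson n i :: 'p fpoly)"
  by (simp add: dickson_eval_def)

declare dickson.simps(2) [simp del]

lemma dickson_beyond: "i > n \<Longrightarrow> dickson n i = 0"
  by (induction n arbitrary: i) (auto simp: dickson_Suc zero_power)

lemma dickson_top: "dickson n n = 1"
  by (induction n) (auto simp: dickson_Suc dickson_beyond)

text \<open>By additivity of Frobenius, raising D to the p-th power raises the coefficients to the
  p-th power and shifts them by one place, which is the first term of the recursion.\<close>

lemma dickson_eval_Suc:
  fixes y :: "'p::prime_card fpoly"
  shows "dickson_eval (Suc n) y = dickson_eval n y ^ CARD('p) -
    dickson_eval n (PX n) ^ (CARD('p) - 1) * dickson_eval n y"
proof -
  let ?d = "dickson_eval n (PX n) ^ (CARD('p) - 1) :: 'p fpoly"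
  have "dickson_eval n y ^ CARD('p) = (\<Sum>k\<le>n. (dickson n k * y ^ (CARD('p) ^ k)) ^ CARD('p))"
    unfolding dickson_eval_def using frob_sum[of _ _ 1] by simp
  also have "\<dots> = (\<Sum>k\<le>n. dickson n k ^ CARD('p) * y ^ (CARD('p) ^ Suc k))"
    by (simp add: power_mult_distrib mult.commute flip: power_mult)
  also have "\<dots> = (\<Sum>k\<le>Suc n. (if k = 0 then 0 else dickson n (k - 1) ^ CARD('p)) * y ^ (CARD('p) ^ k))"
    by (simp add: sum.atMost_Suc_shift del: sum.atMost_Suc)
  finally have 1: "dickson_eval n y ^ CARD('p) =
    (\<Sum>k\<le>Suc n. (if k = 0 then 0 else dickson n (k - 1) ^ CARD('p)) * y ^ (CARD('p) ^ k))" .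
  have "?d * dickson_eval n y = (\<Sum>k\<le>Suc n. ?d * dickson n k * y ^ (CARD('p) ^ k))"
    by (simp add: dickson_eval_def[of n y] dickson_beyond sum_distrib_left mult.assoc)
  then show ?thesis
    unfolding 1 dickson_eval_def[of "Suc n"] dickson_Suc
    by (simp add: left_diff_distrib sum_subtractf)
qed

text \<open>Old roots persist because D divides D^p - D(x_n)^(p-1) D; at the new variable the two
  terms coincide.\<close>

lemma dickson_eval_PX: "j < n \<Longrightarrow> dickson_eval n (PX j :: 'p::prime_card fpoly) = 0"
proof (induction n)
  case (Suc n)
  show ?case
  proof (cases "j = n")
    case True
    obtain m where "CARD('p) = Suc m" using CARD_gt_1[where 'p = 'p] by (cases "CARD('p)") auto
    then show ?thesis using True by (simp add: dickson_eval_Suc)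
  next
    case False
    then show ?thesis using Suc by (simp add: dickson_eval_Suc zero_power)
  qed
qed simp

lemma psubst_dickson_eval:
  "psubst \<sigma> (dickson_eval n y :: 'p::prime_card fpoly) =
    (\<Sum>k\<le>n. psubst \<sigma> (dickson n k) * psubst \<sigma> y ^ (CARD('p) ^ k))"
  by (simp add: dickson_eval_def psubst.hom_sum psubst.hom_mult psubst.hom_power)

text \<open>When all the variables vanish, every root is 0 and the polynomial degenerates to
  X^(p^n).\<close>

lemma psubst_dickson_zero:
  fixes \<sigma> :: "nat \<Rightarrow> 'p::prime_card fpoly"
  assumes "\<And>j. j < n \<Longrightarrow> \<sigma> j = 0"
  shows "psubst \<sigma> (dickson n i) = (if i = n then 1 else 0)"
  using assms
proof (induction n arbitrary: i)
  case (Suc n)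
  have "psubst \<sigma> (dickson_eval n (PX n)) = 0"
    using Suc by (simp add: psubst_dickson_eval zero_power)
  moreover have "CARD('p) - 1 > 0" using CARD_gt_1[where 'p = 'p] by simp
  ultimately show ?case
    using Suc by (auto simp: dickson_Suc psubst.hom_minus psubst.hom_mult psubst.hom_power zero_power)
qed simp

text \<open>Killing the first n variables leaves x_n^(p^n).\<close>

lemma dickson_eval_PX_neq_0: "dickson_eval n (PX n) \<noteq> (0 :: 'p::prime_card fpoly)"
proof
  let ?\<sigma> = "\<lambda>j. if j < n then 0 else PX j :: 'p fpoly"
  assume "dickson_eval n (PX n) = (0 :: 'p fpoly)"
  then have "psubst ?\<sigma> (dickson_eval n (PX n)) = 0" by simp
  moreover have "psubst ?\<sigma> (dickson_eval n (PX n)) = PX n ^ (CARD('p) ^ n)"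
    by (simp add: psubst_dickson_eval psubst_dickson_zero)
      (simp add: if_distrib[of "\<lambda>a. a * _"] cong: if_cong)
  ultimately show False by simp
qed

text \<open>Unfolding the recursion, the lowest coefficient is up to sign the product of the
  D_k(x_k)^(p-1) for k < n.\<close>

lemma dickson_0_neq_0: "dickson n 0 \<noteq> (0 :: 'p::prime_card fpoly)"
  by (induction n) (auto simp: dickson_Suc dickson_eval_PX_neq_0)

text \<open>Only the first n variables occur in \<open>dickson n i\<close>.\<close>

lemma psubst_dickson_same:
  fixes \<sigma> :: "nat \<Rightarrow> 'p::prime_card fpoly"
  assumes "\<And>j. j < n \<Longrightarrow> \<sigma> j = PX j"
  shows "psubst \<sigma> (dickson n i) = dickson n i"
  using assms
proof (induction n arbitrary: i)
  case (Suc n)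
  have "psubst \<sigma> (dickson_eval n (PX n)) = dickson_eval n (PX n)"
    using Suc by (simp add: psubst_dickson_eval) (simp add: dickson_eval_def)
  then show ?case
    using Suc by (auto simp: dickson_Suc psubst.hom_minus psubst.hom_mult psubst.hom_power)
qed simp

lemma psubst_dickson_last:
  fixes \<sigma> :: "nat \<Rightarrow> 'p::prime_card fpoly"
  assumes "\<And>j. j < n \<Longrightarrow> \<sigma> j = PX j" "\<sigma> n = 0"
  shows "psubst \<sigma> (dickson (Suc n) i) = (if i = 0 then 0 else dickson n (i - 1) ^ CARD('p))"
proof -
  have "psubst \<sigma> (dickson_eval n (PX n)) = 0"
    using assms by (simp add: psubst_dickson_eval zero_power)
  moreover have "CARD('p) - 1 > 0" using CARD_gt_1[where 'p = 'p] by simp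
  ultimately show ?thesis
    using psubst_dickson_same[of n \<sigma>] assms
    by (auto simp: dickson_Suc psubst.hom_minus psubst.hom_mult psubst.hom_power zero_power)
qed

text \<open>Setting the last variable to 0 kills the lowest Dickson polynomial and turns the others
  into \<open>p\<close>-th powers of those in one variable less.\<close>

theorem dickson_algebraically_independent:
  fixes c :: "(nat \<Rightarrow> nat) \<Rightarrow> 'p::prime_card mod_ring"
  assumes "finite F" "\<And>m s. m \<in> F \<Longrightarrow> s \<ge> n \<Longrightarrow> m s = 0"
    and "(\<Sum>m\<in>F. PC (c m) * (\<Prod>s<n. dickson n s ^ m s)) = 0"
    and "m \<in> F"
  shows "c m = 0"
  using assms
proof (induction n arbitrary: F c m)
  case 0
  have "m' = (\<lambda>_. 0)" if "m' \<in> F" for m' using 0(2)[OF that] by auto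
  then have "F = {\<lambda>_. 0}" using \<open>m \<in> F\<close> by auto
  then show ?case using 0 by simp
next
  case (Suc n)
  let ?D = "dickson (Suc n) :: nat \<Rightarrow> 'p fpoly"
  show ?case
  proof (rule ccontr)
    assume cm: "c m \<noteq> 0"
    define F' where "F' = {m\<in>F. c m \<noteq> 0}"
    \<comment> \<open>The lowest power of \<open>?D 0\<close> in the relation. After cancelling it,
      setting the last variable to 0 leaves exactly the terms whose exponent at 0 is k, and
      \<open>m0\<close> is one of them.\<close>
    define k where "k = Min ((\<lambda>m. m 0) ` F')"
    have F': "finite F'" "m \<in> F'" using Suc.prems cm by (auto simp: F'_def)
    have k_le: "k \<le> m 0" if "m \<in> F'" for m using F' that by (simp add: k_def)
    have "k \<in> (\<lambda>m. m 0) ` F'" unfolding k_def using F' by (intro Min_in) auto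
    then obtain m0 where m0: "m0 \<in> F'" "m0 0 = k" by auto
    have "0 = (\<Sum>m\<in>F'. PC (c m) * (\<Prod>s<Suc n. ?D s ^ m s))"
      unfolding Suc.prems(3)[symmetric] F'_def
      by (rule sum.mono_neutral_right) (use Suc.prems in auto)
    also have "\<dots> = (\<Sum>m\<in>F'. ?D 0 ^ k * (PC (c m) * ?D 0 ^ (m 0 - k) * (\<Prod>s<n. ?D (Suc s) ^ m (Suc s))))"
    proof (rule sum.cong[OF refl])
      fix m assume "m \<in> F'"
      then have "?D 0 ^ m 0 = ?D 0 ^ k * ?D 0 ^ (m 0 - k)" using k_le by (simp flip: power_add)
      then show "PC (c m) * (\<Prod>s<Suc n. ?D s ^ m s) =
          ?D 0 ^ k * (PC (c m) * ?D 0 ^ (m 0 - k) * (\<Prod>s<n. ?D (Suc s) ^ m (Suc s)))"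
        by (simp add: prod.lessThan_Suc_shift mult_ac del: prod.lessThan_Suc)
    qed
    finally have "(\<Sum>m\<in>F'. PC (c m) * ?D 0 ^ (m 0 - k) * (\<Prod>s<n. ?D (Suc s) ^ m (Suc s))) = 0"
      by (simp add: dickson_0_neq_0 flip: sum_distrib_left)
    then have "psubst (PX(n := 0)) (\<Sum>m\<in>F'. PC (c m) * ?D 0 ^ (m 0 - k) * (\<Prod>s<n. ?D (Suc s) ^ m (Suc s))) = 0"
      by simp
    then have "0 = (\<Sum>m\<in>F'. PC (c m) * 0 ^ (m 0 - k) * (\<Prod>s<n. (dickson n s ^ CARD('p)) ^ m (Suc s)))"
      by (simp add: psubst.hom_sum psubst.hom_mult psubst.hom_power psubst.hom_prod psubst_dickson_last)
    also have "\<dots> = (\<Sum>m\<in>{m\<in>F'. m 0 = k}. PC (c m) * (\<Prod>s<n. dickson n s ^ (CARD('p) * m (Suc s))))"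
      by (rule sum.mono_neutral_cong_right) (use F' in \<open>auto simp: power_mult zero_power dest: k_le\<close>)
    finally have 0: "(\<Sum>m\<in>{m\<in>F'. m 0 = k}. PC (c m) * (\<Prod>s<n. dickson n s ^ (CARD('p) * m (Suc s)))) = 0"
      by simp
    \<comment> \<open>The surviving exponent vectors, shifted by one index and multiplied by p
      because the substitution yields p-th powers. No information is lost, as the dropped entry
      \<open>m 0\<close> is always k.\<close>
    let ?g = "\<lambda>(m :: nat \<Rightarrow> nat) s. CARD('p) * m (Suc s)"
    have inj: "inj_on ?g {m\<in>F'. m 0 = k}"
    proof (rule inj_onI)
      fix a b assume ab: "a \<in> {m\<in>F'. m 0 = k}" "b \<in> {m\<in>F'. m 0 = k}" "?g a = ?g b"
      have "a s = b s" for s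
      proof (cases s)
        case (Suc s')
        then show ?thesis using fun_cong[OF ab(3), of s'] by simp
      qed (use ab in simp)
      then show "a = b" by blast
    qed
    let ?h = "the_inv_into {m\<in>F'. m 0 = k} ?g"
    have h: "?h (?g m) = m" if "m \<in> {m\<in>F'. m 0 = k}" for m
      using the_inv_into_f_f[OF inj that] .
    have "c (?h (?g m0)) = 0"
    proof (rule Suc.IH[of "?g ` {m\<in>F'. m 0 = k}" "\<lambda>m. c (?h m)"])
      show "(\<Sum>m\<in>?g ` {m\<in>F'. m 0 = k}. PC (c (?h m)) * (\<Prod>s<n. dickson n s ^ m s)) = 0"
        using 0 by (simp add: sum.reindex[OF inj] h)
    qed (use F' m0 Suc.prems in \<open>auto simp: F'_def\<close>)
    then show False using m0 h by (simp add: F'_def)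
  qed
qed

text \<open>A vanishing \<open>dickson n i\<close> would be an algebraic relation consisting of one
  monomial.\<close>

lemma dickson_neq_0:
  assumes "i < n"
  shows "dickson n i \<noteq> (0 :: 'p::prime_card fpoly)"
proof
  assume "dickson n i = (0 :: 'p fpoly)"
  let ?m = "\<lambda>s. if s = i then 1 else 0 :: nat"
  have "(\<Prod>s<n. dickson n s ^ ?m s) = (0 :: 'p fpoly)"
    using assms \<open>dickson n i = 0\<close> by (intro prod_zero) auto
  then have "(1 :: 'p mod_ring) = 0"
    using dickson_algebraically_independent[of "{?m}" n "\<lambda>_. 1" ?m] assms by auto
  then show False by simp
qed

section \<open>Moore determinants\<close>

definition moore :: "nat \<Rightarrow> 'p::prime_card fpoly mat" where
  "moore n = mat n n (\<lambda>(i, j). PX i ^ (CARD('p) ^ j))"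

lemma moore_carrier [simp]: "moore n \<in> carrier_mat n n"
  by (simp add: moore_def)

lemma Ln_bracket: "Ln n = bracket [0..<n]"
proof -
  have "filter (\<lambda>r. r \<noteq> n) [0..<n] = [0..<n]" by (simp add: filter_id_conv)
  then show ?thesis by (simp add: Ln_def Lni_def)
qed

lemma Ln_moore: "Ln n = det (moore n)"
  unfolding Ln_bracket bracket_def moore_def by (rule arg_cong[of _ _ det]) auto

text \<open>Column operations turn the last column of the Moore matrix into the values D_n(x_a),
  which vanish for a < n; expanding along that column leaves one minor.\<close>

lemma Ln_Suc: "Ln (Suc n) = dickson_eval n (PX n) * (Ln n :: 'p::prime_card fpoly)"
proof -
  \<comment> \<open>Encodes the column operations; it is unipotent because D_n is monic.\<close>
  let ?C = "mat (Suc n) (Suc n) (\<lambda>(r, j). if j = n then dickson n r else if r = j then 1 else 0) :: 'p fpoly mat"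
  define M where "M = moore (Suc n) * ?C"
  have C: "?C \<in> carrier_mat (Suc n) (Suc n)" by simp
  have "det ?C = prod_list (diag_mat ?C)"
    by (rule det_upper_triangular[of _ "Suc n"]) (auto simp: upper_triangular_def)
  also have "\<dots> = 1"
  proof -
    have "diag_mat ?C = map (\<lambda>_. 1) [0..<Suc n]"
      unfolding diag_mat_def by (rule map_cong) (auto simp: dickson_top)
    then show ?thesis by (simp add: prod_list_replicate map_replicate_const)
  qed
  finally have detC: "det ?C = 1" .
  have M_index: "M $$ (a, j) = (if j = n then dickson_eval n (PX a) else PX a ^ (CARD('p) ^ j))"
    if "a < Suc n" "j < Suc n" for a j
  proof -
    have "M $$ (a, j) = (\<Sum>r = 0..<Suc n. PX a ^ (CARD('p) ^ r) *
        (if j = n then dickson n r else if r = j then 1 else 0))"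
      using that by (simp add: M_def moore_def scalar_prod_def del: sum.op_ivl_Suc)
    also have "\<dots> = (if j = n then dickson_eval n (PX a) else PX a ^ (CARD('p) ^ j))"
    proof (cases "j = n")
      case True
      then show ?thesis
        by (simp add: dickson_eval_def lessThan_Suc_atMost[symmetric] lessThan_atLeast0 mult.commute
          del: sum.op_ivl_Suc sum.lessThan_Suc)
    next
      case False
      then show ?thesis using that
        by (simp add: if_distrib[of "\<lambda>x. _ * x"] sum.delta cong: if_cong del: sum.op_ivl_Suc)
    qed
    finally show ?thesis .
  qed
  have dim: "dim_row M = Suc n" "dim_col M = Suc n" by (simp_all add: M_def moore_def)
  have "Ln (Suc n) = det M"
    using det_mult[of "moore (Suc n)" "Suc n" ?C] detC by (simp add: Ln_moore M_def)
  also have "\<dots> = (\<Sum>i<Suc n. M $$ (i, n) * cofactor M i n)"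
    by (rule laplace_expansion_column) (auto simp: M_def moore_def)
  also have "\<dots> = M $$ (n, n) * cofactor M n n"
    by (simp add: M_index dickson_eval_PX)
  also have "cofactor M n n = det (moore n)"
  proof -
    have "mat_delete M n n = moore n"
      by (rule eq_matI) (auto simp: mat_delete_def M_index dim moore_def)
    then show ?thesis by (simp add: cofactor_def)
  qed
  finally show ?thesis by (simp add: M_index Ln_moore)
qed

lemma Ln_neq_0: "Ln n \<noteq> (0 :: 'p::prime_card fpoly)"
proof (induction n)
  case 0
  then show ?case by (simp add: Ln_moore)
qed (simp add: Ln_Suc dickson_eval_PX_neq_0)

text \<open>Reordering the exponents permutes the columns of the matrix.\<close>

lemma bracket_mset_eq:
  assumes "mset r = mset r'"
  obtains u :: int where "u \<in> {1, -1}" "bracket r = (of_int u * bracket r' :: 'p::prime_card fpoly)"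
proof -
  let ?n = "length r'"
  obtain \<pi> where \<pi>: "\<pi> permutes {..<?n}" "permute_list \<pi> r' = r"
    using mset_eq_permutation[OF assms] by blast
  let ?A = "mat ?n ?n (\<lambda>(j, i). PX i ^ (CARD('p) ^ (r' ! j))) :: 'p fpoly mat"
  have p0: "\<pi> permutes {0..<?n}" using \<pi>(1) by (simp add: atLeast0LessThan)
  have len: "length r = ?n" using \<pi>(2) by auto
  \<comment> \<open>Transposed so that exponents index rows, the form that
    \<open>det_permute_rows\<close> acts on.\<close>
  have tr: "(bracket s :: 'p fpoly) = det (mat (length s) (length s) (\<lambda>(j, i). PX i ^ (CARD('p) ^ (s ! j))))"
    for s :: "nat list"
  proof -
    have "mat (length s) (length s) (\<lambda>(i, j). PX i ^ (CARD('p) ^ (s ! j))) =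
        transpose_mat (mat (length s) (length s) (\<lambda>(j, i). PX i ^ (CARD('p) ^ (s ! j))) :: 'p fpoly mat)"
      by (rule eq_matI) auto
    then show ?thesis by (simp only: bracket_def) (rule det_transpose[of _ "length s"], simp)
  qed
  have "mat (length r) (length r) (\<lambda>(j, i). PX i ^ (CARD('p) ^ (r ! j))) =
      mat ?n ?n (\<lambda>(j, i). ?A $$ (\<pi> j, i))"
    using \<pi> len permutes_in_image[OF p0]
    by (intro eq_matI) (auto simp flip: \<pi>(2) simp: permute_list_nth)
  then have "bracket r = of_int (sign \<pi>) * (bracket r' :: 'p fpoly)"
    unfolding tr using det_permute_rows[of ?A ?n \<pi>] p0 by simp
  then show ?thesis using that[of "sign \<pi>"] by (auto simp: sign_def)
qed

text \<open>Cramer's rule. The equations D_n(x_a) = 0, solved for the top term, are a linear system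
  with the Moore matrix and the negated Dickson coefficients as solution.\<close>

lemma Lni_dickson:
  assumes "i < n"
  obtains u :: int where "u \<in> {1, -1}" "Lni n i = (of_int u * dickson n i * Ln n :: 'p::prime_card fpoly)"
proof -
  let ?v = "vec n (\<lambda>r. - dickson n r) :: 'p fpoly vec"
  \<comment> \<open>The exponents of L_{n,i}, with n placed at position i, where Cramer's rule
    replaces the column.\<close>
  let ?r = "[0..<n][i := n]"
  have "mset (filter (\<lambda>r. r \<noteq> i) [0..<Suc n]) = mset ?r"
    using assms by (subst set_eq_iff_mset_eq_distinct[symmetric])
      (auto simp: set_update_distinct distinct_list_update)
  then obtain u where u: "u \<in> {1, -1}" "Lni n i = (of_int u * bracket ?r :: 'p fpoly)"
    unfolding Lni_def by (rule bracket_mset_eq)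
  have mv: "moore n *\<^sub>v ?v = vec n (\<lambda>a. PX a ^ (CARD('p) ^ n))"
  proof (rule eq_vecI)
    fix a assume "a < dim_vec (vec n (\<lambda>a. PX a ^ (CARD('p) ^ n) :: 'p fpoly))"
    then have a: "a < n" by simp
    have "(\<Sum>r<n. PX a ^ (CARD('p) ^ r) * dickson n r) + PX a ^ (CARD('p) ^ n) = (0 :: 'p fpoly)"
      using dickson_eval_PX[OF a]
      by (simp add: dickson_eval_def lessThan_Suc_atMost[symmetric] dickson_top mult.commute)
    then show "(moore n *\<^sub>v ?v) $ a = vec n (\<lambda>a. PX a ^ (CARD('p) ^ n)) $ a"
      using a by (simp add: moore_def scalar_prod_def sum_negf atLeast0LessThan neg_eq_iff_add_eq_0)
  qed (simp add: moore_def)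
  have "replace_col (moore n) (moore n *\<^sub>v ?v) i =
      mat (length ?r) (length ?r) (\<lambda>(a, j). PX a ^ (CARD('p) ^ (?r ! j)))"
    unfolding mv replace_col_def
    by (rule eq_matI) (use assms in \<open>auto simp: moore_def nth_list_update\<close>)
  then have "bracket ?r = - dickson n i * (Ln n :: 'p fpoly)"
    unfolding bracket_def Ln_moore
    using cramer_lemma_mat[OF moore_carrier, of ?v n i] assms by simp
  then have "Lni n i = of_int (- u) * dickson n i * (Ln n :: 'p fpoly)" using u by simp
  then show ?thesis using u(1) that[of "- u"] by auto
qed

text \<open>Omitting 0 raises all the exponents of L_n by one, so each entry is a p-th power, and
  Frobenius commutes with determinants.\<close>

lemma Lni_0: "Lni n 0 = (Ln n :: 'p::prime_card fpoly) ^ CARD('p)"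
proof -
  interpret frob: comm_ring_hom "\<lambda>x :: 'p fpoly. x ^ CARD('p)" by (rule comm_ring_hom_frob)
  have "filter (\<lambda>r. r \<noteq> 0) [0..<Suc n] = map Suc [0..<n]"
    by (simp add: upt_conv_Cons map_Suc_upt filter_id_conv del: upt_Suc)
  then have "Lni n 0 = (bracket (map Suc [0..<n]) :: 'p fpoly)" by (simp add: Lni_def)
  also have "\<dots> = det (map_mat (\<lambda>x. x ^ CARD('p)) (moore n))"
    unfolding bracket_def
    by (rule arg_cong[of _ _ det], rule eq_matI) (auto simp: moore_def mult.commute simp flip: power_mult)
  also have "\<dots> = Ln n ^ CARD('p)" by (simp add: Ln_moore)
  finally show ?thesis .
qed

section \<open>The action of GL_n on Moore determinants\<close>

lemma psubst_linear_power:
  "(\<Sum>k\<in>X. PC (a k) * PX k) ^ (CARD('p) ^ r) =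
    (\<Sum>k\<in>X. PC (a k) * (PX k ^ (CARD('p) ^ r) :: 'p::prime_card fpoly))"
  by (simp add: frob_sum power_mult_distrib)

lemma gl_poly_psubst: "gl_poly A = psubst (\<lambda>s. \<Sum>i = 0..<dim_row A. PC (A $$ (i, s)) * PX i)"
  by (rule ext) (simp add: gl_poly_def psubst_def)

text \<open>The coefficients of the linear forms are fixed by Frobenius, so every column transforms
  by the same matrix, the transpose of \<open>A\<close>.\<close>

lemma gl_poly_bracket:
  fixes A :: "'p::prime_card mod_ring mat"
  assumes A: "A \<in> carrier_mat n n" and r: "length r = n"
  shows "gl_poly A (bracket r) = PC (det A) * bracket r"
proof -
  let ?B = "mat n n (\<lambda>(i, j). PX i ^ (CARD('p) ^ (r ! j))) :: 'p fpoly mat"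
  let ?P = "transpose_mat (map_mat PC A)"
  have "gl_poly A (det ?B) = det (map_mat (gl_poly A) ?B)"
    unfolding gl_poly_psubst by (rule psubst.hom_det[symmetric])
  also have "map_mat (gl_poly A) ?B = ?P * ?B"
    using A by (intro eq_matI)
      (auto simp: gl_poly_psubst psubst.hom_power psubst_linear_power scalar_prod_def)
  also have "det (?P * ?B) = det ?P * det ?B" by (rule det_mult[of _ n]) (use A in auto)
  also have "det ?P = PC (det A)" using A by (simp add: det_transpose[of _ n])
  finally show ?thesis by (simp add: bracket_def r)
qed

lemma length_Lni: "i \<le> n \<Longrightarrow> length (filter (\<lambda>r. r \<noteq> i) [0..<Suc n]) = n"
proof -
  assume "i \<le> n"
  then have "set (filter (\<lambda>r. r \<noteq> i) [0..<Suc n]) = {0..<Suc n} - {i}" by auto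
  moreover have "card ({0..<Suc n} - {i}) = n" using \<open>i \<le> n\<close> by simp
  ultimately show ?thesis by (metis distinct_card distinct_filter distinct_upt)
qed

lemma gl_poly_Ln: "A \<in> carrier_mat n n \<Longrightarrow> gl_poly A (Ln n) = PC (det A) * Ln n"
  unfolding Ln_def Lni_def by (rule gl_poly_bracket) (simp_all only: length_Lni order_refl)

lemma invertible_mat_det_neq_0:
  fixes A :: "'a::field mat"
  assumes A: "A \<in> carrier_mat n n" and inv: "invertible_mat A"
  shows "det A \<noteq> 0"
proof -
  obtain B where B: "A * B = 1\<^sub>m n" "B * A = 1\<^sub>m (dim_row B)"
    using A inv by (auto simp: invertible_mat_def inverts_mat_def)
  have "dim_col B = n" using arg_cong[OF B(1), of dim_col] by simp
  moreover have "dim_row B = n" using arg_cong[OF B(2), of dim_col] A by simp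
  ultimately have "B \<in> carrier_mat n n" by auto
  then have "det A * det B = 1" using det_mult[OF A] B(1) by (metis det_one)
  then show ?thesis by auto
qed

text \<open>Up to sign a quotient of two determinants that are both multiplied by det A, which
  cancels.\<close>

lemma gl_poly_dickson:
  fixes A :: "'p::prime_card mod_ring mat"
  assumes A: "A \<in> carrier_mat n n" and inv: "invertible_mat A" and i: "i < n"
  shows "gl_poly A (dickson n i) = dickson n i"
proof -
  obtain u :: int where u: "u \<in> {1, -1}" "Lni n i = (of_int u * dickson n i * Ln n :: 'p fpoly)"
    using Lni_dickson[OF i] .
  have "gl_poly A (Lni n i) = PC (det A) * Lni n i"
    unfolding Lni_def by (rule gl_poly_bracket[OF A length_Lni]) (use i in simp)
  then have "of_int u * gl_poly A (dickson n i) * (PC (det A) * Ln n) =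
      of_int u * dickson n i * (PC (det A) * Ln n)"
    using gl_poly_Ln[OF A] unfolding u(2)
    by (auto simp: gl_poly_psubst psubst.hom_mult psubst.hom_of_int mult_ac)
  moreover have "det A \<noteq> 0" by (rule invertible_mat_det_neq_0[OF A inv])
  ultimately show ?thesis using u(1) Ln_neq_0[of n, where 'p = 'p] by auto
qed

section \<open>The embedding into the localized ring\<close>

lemma comm_ring_hom_to_fract: "comm_ring_hom (to_fract :: 'a::idom \<Rightarrow> 'a fract)"
  by standard simp_all

interpretation to_fract: comm_ring_hom "to_fract :: 'a::idom \<Rightarrow> 'a fract"
  by (rule comm_ring_hom_to_fract)

lemma to_loc_mult:
  fixes g h :: "'p::prime_card fpoly exterior"
  shows "to_loc (g * h) = to_loc g * to_loc h"
proof (rule exterior_eqI)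
  fix S :: "nat set"
  have "to_fract (ext_sign A B :: 'p fpoly) = ext_sign A B" for A B
    by (simp add: ext_sign_def to_fract.hom_power)
  then show "ext_coeff (to_loc (g * h)) S = ext_coeff (to_loc g * to_loc h) S"
    by (simp add: ext_coeff_to_loc times_exterior.rep_eq)
qed

lemma to_loc_const [simp]: "to_loc (ext_const c) = ext_const (to_fract c)"
  by (rule exterior_eqI) (simp add: ext_coeff_to_loc ext_const.rep_eq)

lemma to_loc_gen [simp]: "to_loc (ext_gen i) = ext_gen i"
  by (rule exterior_eqI) (simp add: ext_coeff_to_loc ext_gen.rep_eq)

lemma ring_hom_to_loc: "Ring_Hom.ring_hom to_loc"
proof
  show "to_loc (g + h) = to_loc g + to_loc h" for g h :: "'a fpoly exterior"
    by (rule exterior_eqI) (simp add: ext_coeff_to_loc plus_exterior.rep_eq)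
  show "to_loc 0 = 0" using to_loc_const[of 0] by simp
  show "to_loc 1 = 1" using to_loc_const[of 1] by simp
qed (rule to_loc_mult)

interpretation to_loc: Ring_Hom.ring_hom to_loc
  by (rule ring_hom_to_loc)

section \<open>The basis dual to the Moore matrix\<close>

text \<open>The square of a sum vanishes in every characteristic: the diagonal terms are squares of
  generators, and the mixed terms cancel in pairs.\<close>

lemma anticommuting_linear:
  fixes e :: "nat \<Rightarrow> 'a::comm_ring_1 exterior"
  assumes "anticommuting e" "finite X"
  shows "anticommuting (\<lambda>s. \<Sum>j\<in>X. ext_const (a s j) * e j)"
proof
  interpret anticommuting e by fact
  have swap: "(\<Sum>j\<in>Y. ext_const (c j) * e j) * (\<Sum>k\<in>Z. ext_const (d k) * e k) =
      - ((\<Sum>k\<in>Z. ext_const (d k) * e k) * (\<Sum>j\<in>Y. ext_const (c j) * e j))" for Y Z c d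
  proof -
    have "ext_const (c j) * e j * (ext_const (d k) * e k) =
        - (ext_const (d k) * e k * (ext_const (c j) * e j))" for j k
    proof -
      have "ext_const (c j) * e j * (ext_const (d k) * e k) = ext_const (c j * d k) * (e j * e k)"
        by (simp add: ext_const_mult mult.assoc ext_const_left_commute[of "e _"])
      also have "\<dots> = - (ext_const (d k * c j) * (e k * e j))"
        by (subst anticomm) (simp add: mult.commute)
      also have "ext_const (d k * c j) * (e k * e j) = ext_const (d k) * e k * (ext_const (c j) * e j)"
        by (simp add: ext_const_mult mult.assoc ext_const_left_commute[of "e _"])
      finally show ?thesis .
    qed
    then have "(\<Sum>j\<in>Y. ext_const (c j) * e j) * (\<Sum>k\<in>Z. ext_const (d k) * e k) =
        - (\<Sum>j\<in>Y. \<Sum>k\<in>Z. ext_const (d k) * e k * (ext_const (c j) * e j))"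
      by (simp add: sum_product sum_negf)
    then show ?thesis by (subst (asm) sum.swap) (simp add: sum_product)
  qed
  fix s t
  show "(\<Sum>j\<in>X. ext_const (a s j) * e j) * (\<Sum>j\<in>X. ext_const (a t j) * e j) =
      - ((\<Sum>j\<in>X. ext_const (a t j) * e j) * (\<Sum>j\<in>X. ext_const (a s j) * e j))"
    by (rule swap)
  show "(\<Sum>j\<in>X. ext_const (a s j) * e j) * (\<Sum>j\<in>X. ext_const (a s j) * e j) = 0"
    using assms(2)
  proof (induction X rule: finite_induct)
    case (insert x X)
    have "ext_const (a s x) * e x * (ext_const (a s x) * e x) = 0"
      by (simp add: mult.assoc ext_const_left_commute[of "e _"] square_zero)
    moreover have "ext_const (a s x) * e x * (\<Sum>j\<in>X. ext_const (a s j) * e j) =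
        - ((\<Sum>j\<in>X. ext_const (a s j) * e j) * (ext_const (a s x) * e x))"
      using swap[where Y = "{x}" and c = "a s" and Z = X and d = "a s"] by simp
    ultimately show ?case using insert by (simp add: distrib_left distrib_right)
  qed simp
qed

text \<open>The f_s of the overview: the adjugate divided by \<open>Ln n\<close> is the inverse
  Moore matrix.\<close>

definition dual_gen :: "nat \<Rightarrow> nat \<Rightarrow> 'p::prime_card fpoly fract exterior" where
  "dual_gen n s = (\<Sum>j = 0..<n.
     ext_const (to_fract (adj_mat (moore n) $$ (s, j)) / to_fract (Ln n)) * ext_gen j)"

lemma anticommuting_dual_gen: "anticommuting (dual_gen n)"
  unfolding dual_gen_def[abs_def] by (rule anticommuting_linear[OF anticommuting_ext_gen]) simp

text \<open>The two adjugate identities have separate uses: this one evaluates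
  \<open>moore_map\<close> on f_s, its mirror image writes e_j in terms of the f_r.\<close>

lemma adj_moore_left:
  assumes "s < n" "r < n"
  shows "(\<Sum>j = 0..<n. adj_mat (moore n) $$ (s, j) * PX j ^ (CARD('p) ^ r)) =
    (if s = r then Ln n else 0 :: 'p::prime_card fpoly)"
proof -
  note adj = adj_mat[OF moore_carrier[where 'a = 'p, of n]]
  have "(adj_mat (moore n) * moore n) $$ (s, r) =
      (\<Sum>j = 0..<n. adj_mat (moore n) $$ (s, j) * PX j ^ (CARD('p) ^ r) :: 'p fpoly)"
    using assms carrier_matD[OF adj(1)] by (simp add: scalar_prod_def moore_def)
  moreover have "(det (moore n) \<cdot>\<^sub>m 1\<^sub>m n) $$ (s, r) = (if s = r then Ln n else 0 :: 'p fpoly)"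
    using assms by (simp add: Ln_moore)
  ultimately show ?thesis by (simp only: adj(3))
qed

lemma adj_moore_right:
  assumes "i < n" "j < n"
  shows "(\<Sum>r = 0..<n. adj_mat (moore n) $$ (r, j) * PX i ^ (CARD('p) ^ r)) =
    (if i = j then Ln n else 0 :: 'p::prime_card fpoly)"
proof -
  note adj = adj_mat[OF moore_carrier[where 'a = 'p, of n]]
  have "(moore n * adj_mat (moore n)) $$ (i, j) =
      (\<Sum>r = 0..<n. adj_mat (moore n) $$ (r, j) * PX i ^ (CARD('p) ^ r) :: 'p fpoly)"
    using assms carrier_matD[OF adj(1)] by (simp add: scalar_prod_def moore_def mult.commute)
  moreover have "(det (moore n) \<cdot>\<^sub>m 1\<^sub>m n) $$ (i, j) = (if i = j then Ln n else 0 :: 'p fpoly)"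
    using assms by (simp add: Ln_moore)
  ultimately show ?thesis by (simp only: adj(2))
qed

lemma ext_const_mult_right:
  "ext_const a * g * ext_const (b::'a::comm_ring_1) = ext_const (a * b) * g"
  by (simp add: ext_const_mult mult.assoc ext_const_commute[of g b])

lemma gen_eq_dual_gen:
  assumes "j < n"
  shows "(\<Sum>r = 0..<n. dual_gen n r * ext_const (to_fract (PX j ^ (CARD('p) ^ r)))) =
    (ext_gen j :: 'p::prime_card fpoly fract exterior)"
proof -
  have "(\<Sum>r = 0..<n. dual_gen n r * ext_const (to_fract (PX j ^ (CARD('p) ^ r)))) =
      (\<Sum>r = 0..<n. \<Sum>i = 0..<n. ext_const (to_fract (adj_mat (moore n) $$ (r, i) * PX j ^ (CARD('p) ^ r)) /
        to_fract (Ln n)) * (ext_gen i :: 'p fpoly fract exterior))"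
    by (simp add: dual_gen_def sum_distrib_right ext_const_mult_right)
  also have "\<dots> = (\<Sum>i = 0..<n. ext_const (to_fract
      (\<Sum>r = 0..<n. adj_mat (moore n) $$ (r, i) * PX j ^ (CARD('p) ^ r)) / to_fract (Ln n)) * ext_gen i)"
    by (subst sum.swap) (simp add: ext_const_sum sum_distrib_right sum_divide_distrib)
  also have "\<dots> = (\<Sum>i = 0..<n. if j = i then ext_gen i else 0)"
    by (rule sum.cong[OF refl], subst adj_moore_right[OF assms]) (simp_all add: Ln_neq_0)
  also have "\<dots> = ext_gen j" using assms by simp
  finally show ?thesis .
qed

text \<open>The algebra endomorphism over the fraction field that sends f_s to e_s. Through it,
  coefficients with respect to the f_S can be read off as coefficients with respect to the monomials
  e_S.\<close>

definition moore_map :: "nat \<Rightarrow> 'p::prime_card fpoly fract exterior \<Rightarrow> 'p fpoly fract exterior" where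
  "moore_map n = ext_map (\<lambda>c. c)
     (\<lambda>j. \<Sum>r = 0..<n. ext_const (to_fract (PX j ^ (CARD('p) ^ r))) * ext_gen r)"

lemma ext_hom_moore_map: "ext_hom (\<lambda>c. c)
  (\<lambda>j. \<Sum>r = 0..<n. ext_const (to_fract (PX j ^ (CARD('p) ^ r))) * (ext_gen r :: 'p::prime_card fpoly fract exterior))"
proof -
  have "comm_ring_hom (\<lambda>c :: 'p fpoly fract. c)" by standard simp_all
  then show "ext_hom (\<lambda>c. c) (\<lambda>j. \<Sum>r = 0..<n. ext_const (to_fract (PX j ^ (CARD('p) ^ r))) *
      (ext_gen r :: 'p fpoly fract exterior))"
    by (intro ext_hom.intro anticommuting_linear[OF anticommuting_ext_gen]) simp_all
qed

lemma moore_map_mult: "moore_map n (g * h) = moore_map n g * moore_map n h"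
  unfolding moore_map_def by (rule ext_hom.ext_map_mult[OF ext_hom_moore_map])

lemma moore_map_sum: "moore_map n (sum f A) = (\<Sum>x\<in>A. moore_map n (f x))"
  unfolding moore_map_def by (rule ext_hom.ext_map_sum[OF ext_hom_moore_map])

lemma moore_map_const [simp]: "moore_map n (ext_const c) = ext_const c"
  unfolding moore_map_def by (rule ext_hom.ext_map_const[OF ext_hom_moore_map])

lemma moore_map_1 [simp]: "moore_map n 1 = 1"
  unfolding moore_map_def by (rule ext_hom.ext_map_1[OF ext_hom_moore_map])

lemma moore_map_gen: "moore_map n (ext_gen j) =
  (\<Sum>r = 0..<n. ext_const (to_fract (PX j ^ (CARD('p) ^ r))) * (ext_gen r :: 'p::prime_card fpoly fract exterior))"
  unfolding moore_map_def by (rule ext_hom.ext_map_gen[OF ext_hom_moore_map])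

lemma moore_map_dual_gen:
  assumes "s < n"
  shows "moore_map n (dual_gen n s) = (ext_gen s :: 'p::prime_card fpoly fract exterior)"
proof -
  have "moore_map n (dual_gen n s) = (\<Sum>j = 0..<n. \<Sum>r = 0..<n.
      ext_const (to_fract (adj_mat (moore n) $$ (s, j) * PX j ^ (CARD('p) ^ r)) /
        to_fract (Ln n)) * (ext_gen r :: 'p fpoly fract exterior))"
    by (simp add: moore_map_sum moore_map_mult moore_map_gen dual_gen_def
        sum_distrib_left mult.assoc[symmetric] flip: ext_const_mult)
  also have "\<dots> = (\<Sum>r = 0..<n. ext_const (to_fract
      (\<Sum>j = 0..<n. adj_mat (moore n) $$ (s, j) * PX j ^ (CARD('p) ^ r)) / to_fract (Ln n)) * ext_gen r)"
    by (subst sum.swap) (simp add: ext_const_sum sum_distrib_right sum_divide_distrib)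
  also have "\<dots> = (\<Sum>r = 0..<n. if s = r then ext_gen r else 0)"
    by (rule sum.cong[OF refl], subst adj_moore_left[OF assms]) (simp_all add: Ln_neq_0)
  also have "\<dots> = ext_gen s" using assms by simp
  finally show ?thesis .
qed

lemma moore_map_ord_prod_dual_gen:
  assumes "S \<subseteq> {0..<n}"
  shows "moore_map n (ord_prod (dual_gen n) S) = (ord_prod ext_gen S :: 'p::prime_card fpoly fract exterior)"
proof -
  have "moore_map n (prod_list (map (dual_gen n) xs)) =
      (prod_list (map ext_gen xs) :: 'p fpoly fract exterior)" if "set xs \<subseteq> {0..<n}" for xs
    using that
  proof (induction xs)
    case (Cons x xs)
    then show ?case
      using moore_map_dual_gen[of x n, where 'p = 'p]
      by (simp add: moore_map_mult)
  qed simp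
  moreover have "finite S" using assms finite_subset by blast
  ultimately show ?thesis using assms by (simp add: ord_prod_def)
qed

section \<open>Mui invariants in terms of the dual basis\<close>

text \<open>The defining matrix factors as \<open>?B\<close> times a Moore matrix with reordered
  rows. The second factor gives L_n up to sign, and in the first one all rows from
  \<open>card S\<close> on are identity rows.\<close>

lemma to_loc_Mn:
  fixes S :: "nat set"
  assumes S: "S \<subseteq> {0..<n}"
  obtains u :: int where "u \<in> {1, -1}"
    "to_loc (Mn n S) = ext_const (to_fract (PC (inverse (of_nat (fact (card S)))))) *
      ((\<Sum>\<pi> | \<pi> permutes {0..<card S}. of_int (sign \<pi>) *
        prod_list (map (\<lambda>i. dual_gen n (sorted_list_of_set S ! \<pi> i)) [0..<card S])) *
       ext_const (to_fract (of_int u * (Ln n :: 'p::prime_card fpoly))))"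
proof -
  let ?k = "card S"
  let ?T = "{0..<n} - S"
  \<comment> \<open>With S listed first, the rows of powers of x in the defining matrix are, in
    place, the remaining rows of the reordered Moore matrix.\<close>
  define xs where "xs = sorted_list_of_set S @ sorted_list_of_set ?T"
  have fin: "finite S" using S finite_subset by blast
  have k: "?k \<le> n" using card_mono[OF _ S] by simp
  have set: "set xs = {0..<n}" using S fin by (auto simp: xs_def)
  have dist: "distinct xs" using fin by (auto simp: xs_def)
  have len: "length xs = n" using distinct_card[OF dist] set by simp
  have bij: "bij_betw ((!) xs) {0..<n} {0..<n}"
    by (rule bij_betw_nth[OF dist]) (simp_all only: set len atLeast0LessThan)
  have "mset xs = mset [0..<n]"
    using set dist by (subst set_eq_iff_mset_eq_distinct[symmetric]) auto
  then obtain u where u: "u \<in> {1, -1}" "bracket xs = (of_int u * bracket [0..<n] :: 'p fpoly)"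
    by (rule bracket_mset_eq)
  let ?c = "\<lambda>k j. to_fract (PX j ^ (CARD('p) ^ (xs ! k)) :: 'p fpoly)"
  \<comment> \<open>A row with i < \<open>card S\<close> expresses (e_j) through all the f_r; each
    later row selects a single row of powers.\<close>
  let ?B = "\<lambda>i k. if i < ?k then dual_gen n (xs ! k) else if i = k then 1 else 0 :: 'p fpoly fract exterior"
  have "det (mat n n (\<lambda>(k, j). ?c k j)) =
      det (transpose_mat (map_mat to_fract (mat n n (\<lambda>(i, j). PX i ^ (CARD('p) ^ (xs ! j)) :: 'p fpoly))))"
    by (rule arg_cong[of _ _ det], rule eq_matI) auto
  also have "\<dots> = to_fract (bracket xs)"
    by (subst det_transpose[of _ n]) (simp_all add: bracket_def len)
  finally have det: "det (mat n n (\<lambda>(k, j). ?c k j)) = to_fract (of_int u * Ln n)"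
    by (simp add: u Ln_bracket)
  have "to_loc (row_det n (\<lambda>i j. if i < ?k then ext_gen j
      else ext_const (PX j ^ (CARD('p) ^ (sorted_list_of_set ?T ! (i - ?k)))))) =
    row_det n (\<lambda>i j. \<Sum>k = 0..<n. ?B i k * ext_const (?c k j))"
    unfolding to_loc.hom_row_det
  proof (rule row_det_cong)
    fix i j assume ij: "i < n" "j < n"
    show "to_loc (if i < ?k then ext_gen j
      else ext_const (PX j ^ (CARD('p) ^ (sorted_list_of_set ?T ! (i - ?k))))) =
      (\<Sum>k = 0..<n. ?B i k * ext_const (?c k j))"
    proof (cases "i < ?k")
      case True
      have "(\<Sum>k = 0..<n. ?B i k * ext_const (?c k j)) =
          (\<Sum>k = 0..<n. dual_gen n (xs ! k) * ext_const (?c k j))" using True by simp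
      also have "\<dots> = (\<Sum>r = 0..<n. dual_gen n r * ext_const (to_fract (PX j ^ (CARD('p) ^ r))))"
        by (rule sum.reindex_bij_betw[OF bij])
      finally show ?thesis using True ij by (simp add: gen_eq_dual_gen)
    next
      case False
      then have "xs ! i = sorted_list_of_set ?T ! (i - ?k)"
        using fin by (simp add: xs_def nth_append)
      moreover have "(\<Sum>k = 0..<n. ?B i k * ext_const (?c k j)) =
          (\<Sum>k = 0..<n. if i = k then ext_const (?c k j) else 0)"
        using False by (intro sum.cong) auto
      ultimately show ?thesis using False ij by simp
    qed
  qed
  also have "\<dots> = row_det n ?B * ext_const (to_fract (of_int u * Ln n))"
    unfolding row_det_mult det ..
  also have "row_det n ?B = (\<Sum>\<pi> | \<pi> permutes {0..<?k}. of_int (sign \<pi>) *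
      prod_list (map (\<lambda>i. dual_gen n (xs ! \<pi> i)) [0..<?k]))"
    by (rule row_det_lower_identity[OF k])
  also have "\<dots> = (\<Sum>\<pi> | \<pi> permutes {0..<?k}. of_int (sign \<pi>) *
      prod_list (map (\<lambda>i. dual_gen n (sorted_list_of_set S ! \<pi> i)) [0..<?k]))"
  proof (intro sum.cong refl arg_cong[of _ _ "(*) _"] arg_cong[of _ _ prod_list] map_cong)
    fix \<pi> i assume "\<pi> \<in> {\<pi>. \<pi> permutes {0..<?k}}" "i \<in> set [0..<?k]"
    then have "\<pi> i < ?k" using permutes_in_image[of \<pi> "{0..<?k}" i] by simp
    then show "dual_gen n (xs ! \<pi> i) = dual_gen n (sorted_list_of_set S ! \<pi> i)"
      using fin by (simp add: xs_def nth_append)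
  qed
  finally show ?thesis
    using u(1) by (intro that[of u]) (simp_all add: Mn_def to_loc.hom_mult)
qed

text \<open>The factor L_n from the determinant and L_n^(p-2) from the definition of R combine to
  L_n^(p-1), which is q_{n,0} by \<open>qni_0\<close>.\<close>

lemma to_loc_Rn:
  fixes x :: "'p::prime_card fpoly fract exterior"
  assumes "to_loc (Mn n S) = x * ext_const (to_fract (of_int u * Ln n))"
  shows "to_loc (Rn n S) = ext_const (to_fract (of_int u * Ln n ^ (CARD('p) - 1))) * x"
proof -
  have "CARD('p) - 1 = Suc (CARD('p) - 2)" using CARD_gt_1[where 'p = 'p] by simp
  then have L: "of_int u * Ln n ^ (CARD('p) - 1) = of_int u * Ln n * (Ln n ^ (CARD('p) - 2) :: 'p fpoly)"
    by (simp add: mult.assoc)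
  have "to_loc (Rn n S) = x * ext_const (to_fract (of_int u * Ln n)) *
      ext_const (to_fract (Ln n ^ (CARD('p) - 2)))"
    by (simp only: Rn_def to_loc.hom_mult assms to_loc_const)
  also have "\<dots> = ext_const (to_fract (of_int u * Ln n) * to_fract (Ln n ^ (CARD('p) - 2))) * x"
    by (simp only: mult.assoc ext_const_mult ext_const_left_commute[of x] ext_const_commute[of x])
  finally show ?thesis by (simp only: L to_fract_mult)
qed

lemma to_loc_Rn_single:
  assumes "s < n"
  obtains u :: int where "u \<in> {1, -1}"
    "to_loc (Rn n {s}) = ext_const (to_fract (of_int u * Ln n ^ (CARD('p) - 1))) *
      (dual_gen n s :: 'p::prime_card fpoly fract exterior)"
proof -
  have "{s} \<subseteq> {0..<n}" using assms by auto
  then obtain u where u: "u \<in> {1, -1}"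
    "to_loc (Mn n {s}) = ext_const (to_fract (PC (inverse (of_nat (fact (card {s})))))) *
      ((\<Sum>\<pi> | \<pi> permutes {0..<card {s}}. of_int (sign \<pi>) *
        prod_list (map (\<lambda>i. dual_gen n (sorted_list_of_set {s} ! \<pi> i)) [0..<card {s}])) *
       ext_const (to_fract (of_int u * (Ln n :: 'p fpoly))))"
    by (rule to_loc_Mn)
  then have "to_loc (Mn n {s}) = dual_gen n s * ext_const (to_fract (of_int u * (Ln n :: 'p fpoly)))"
    by simp
  then show ?thesis using that[OF u(1)] to_loc_Rn by blast
qed

text \<open>The two permutations give f_s f_t - f_t f_s = 2 f_s f_t, and the factor 1/2! removes the
  2. This is where p must be odd.\<close>

lemma to_loc_Rn_pair:
  assumes "s < t" "t < n" "odd CARD('p)"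
  obtains u :: int where "u \<in> {1, -1}"
    "to_loc (Rn n {s, t}) = ext_const (to_fract (of_int u * Ln n ^ (CARD('p) - 1))) *
      (dual_gen n s * dual_gen n t :: 'p::prime_card fpoly fract exterior)"
proof -
  interpret anticommuting "dual_gen n :: nat \<Rightarrow> 'p fpoly fract exterior"
    by (rule anticommuting_dual_gen)
  have "(of_nat 2 :: 'p mod_ring) \<noteq> 0"
  proof
    assume "(of_nat 2 :: 'p mod_ring) = 0"
    then have "CARD('p) dvd 2" by (rule of_nat_0_mod_ring_dvd)
    then have "CARD('p) \<le> 2" by (rule dvd_imp_le) simp
    then show False using CARD_gt_1[where 'p = 'p] assms(3) by (cases "CARD('p) = 2") auto
  qed
  then have "PC (inverse (of_nat 2)) * of_nat 2 = (1 :: 'p fpoly)"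
    by (simp add: PC.hom_of_nat[symmetric] del: of_nat_numeral flip: PC_mult)
  moreover have "(of_int 2 :: 'p fpoly fract exterior) = ext_const (to_fract (of_nat 2))"
    by (simp only: ext_const_of_int[symmetric] to_fract.hom_of_int[symmetric] of_int_numeral of_nat_numeral)
  ultimately have half: "ext_const (to_fract (PC (inverse (of_nat 2) :: 'p mod_ring))) * of_int 2 = 1"
    by (simp only: ext_const_mult[symmetric] to_fract_mult[symmetric] to_fract_1 ext_const_1)
  have "{s, t} \<subseteq> {0..<n}" using assms by auto
  then obtain u where u: "u \<in> {1, -1}"
    "to_loc (Mn n {s, t}) = ext_const (to_fract (PC (inverse (of_nat (fact (card {s, t})))))) *
      ((\<Sum>\<pi> | \<pi> permutes {0..<card {s, t}}. of_int (sign \<pi>) *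
        prod_list (map (\<lambda>i. dual_gen n (sorted_list_of_set {s, t} ! \<pi> i)) [0..<card {s, t}])) *
       ext_const (to_fract (of_int u * (Ln n :: 'p fpoly))))"
    by (rule to_loc_Mn)
  have list: "sorted_list_of_set {s, t} = [s, t]" using assms by simp
  have card: "card {s, t} = 2" using assms by simp
  have "{0..<2} = {0, Suc 0}" by auto
  then have perm: "{\<pi>. \<pi> permutes {0..<2}} = {id, transpose 0 (Suc 0)}"
    by (auto simp: permutes_doubleton_iff)
  have "id \<noteq> transpose 0 (Suc 0)" by (metis id_apply n_not_Suc_n transpose_apply_first)
  then have "(\<Sum>\<pi> | \<pi> permutes {0..<2}. of_int (sign \<pi>) *
        prod_list (map (\<lambda>i. dual_gen n ([s, t] ! \<pi> i)) [0..<2])) =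
      dual_gen n s * dual_gen n t - dual_gen n t * (dual_gen n s :: 'p fpoly fract exterior)"
    unfolding perm by (simp add: upt_rec sign_swap_id)
  also have "\<dots> = of_int 2 * (dual_gen n s * dual_gen n t)"
    by (subst anticomm[of t s]) (simp add: mult_2)
  finally have "to_loc (Mn n {s, t}) =
      (ext_const (to_fract (PC (inverse (of_nat 2) :: 'p mod_ring))) * of_int 2) *
      (dual_gen n s * dual_gen n t) * ext_const (to_fract (of_int u * (Ln n :: 'p fpoly)))"
    using u(2) unfolding list card by (simp add: mult.assoc)
  then show ?thesis unfolding half using that[OF u(1)] to_loc_Rn by (metis mult_1)
qed

lemma qni_dickson:
  assumes "i < n"
  obtains u :: int where "u \<in> {1, -1}" "qni n i = to_fract (of_int u * dickson n i :: 'p::prime_card fpoly)"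
proof -
  obtain u :: int where u: "u \<in> {1, -1}" "Lni n i = (of_int u * dickson n i * Ln n :: 'p fpoly)"
    using Lni_dickson[OF assms] .
  then have "qni n i = to_fract (of_int u * dickson n i :: 'p fpoly)"
    by (simp add: qni_def Ln_neq_0)
  then show ?thesis using that u(1) by blast
qed

text \<open>Obtained from \<open>Lni_0\<close> rather than from the Dickson recursion, so that
  q_{n,0} is matched exactly with the power of L_n in R.\<close>

lemma qni_0: "qni n 0 = to_fract (Ln n ^ (CARD('p) - 1) :: 'p::prime_card fpoly)"
proof -
  have "(Ln n :: 'p fpoly) ^ CARD('p) = Ln n ^ (CARD('p) - 1) * Ln n"
    using CARD_gt_1[where 'p = 'p] by (simp add: power_eq_if)
  then show ?thesis by (simp add: qni_def Lni_0 Ln_neq_0)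
qed

section \<open>The subalgebra of invariants\<close>

definition poly_in :: "nat \<Rightarrow> 'p::prime_card fpoly \<Rightarrow> bool" where
  "poly_in n f \<longleftrightarrow> (\<forall>m\<in>Poly_Mapping.keys f. Poly_Mapping.keys m \<subseteq> {0..<n})"

lemma poly_in_add: "poly_in n f \<Longrightarrow> poly_in n g \<Longrightarrow> poly_in n (f + g)"
  unfolding poly_in_def using keys_add[of f g] by blast

lemma poly_in_uminus: "poly_in n f \<Longrightarrow> poly_in n (- f)"
  by (simp add: poly_in_def in_keys_iff)

lemma poly_in_diff: "poly_in n f \<Longrightarrow> poly_in n g \<Longrightarrow> poly_in n (f - g)"
  using poly_in_add[of n f "- g"] poly_in_uminus[of n g] by simp

lemma poly_in_mult:
  assumes "poly_in n f" "poly_in n g"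
  shows "poly_in n (f * g)"
  unfolding poly_in_def
proof
  fix m assume "m \<in> Poly_Mapping.keys (f * g)"
  then obtain a b where "m = a + b" "a \<in> Poly_Mapping.keys f" "b \<in> Poly_Mapping.keys g"
    using keys_mult[of f g] by blast
  then show "Poly_Mapping.keys m \<subseteq> {0..<n}"
    using assms keys_add[of a b] unfolding poly_in_def by blast
qed

lemma poly_in_PC [simp]: "poly_in n (PC c)"
  by (simp add: poly_in_def PC_def)

lemma poly_in_PX: "i < n \<Longrightarrow> poly_in n (PX i)"
  by (simp add: poly_in_def PX_def)

lemma poly_in_0 [simp]: "poly_in n 0"
  by (simp add: poly_in_def)

lemma poly_in_1 [simp]: "poly_in n 1"
  using poly_in_PC[of n 1] by simp

lemma poly_in_of_int [simp]: "poly_in n (of_int k)"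
  using poly_in_PC[of n "of_int k"] by (simp add: PC.hom_of_int)

lemma poly_in_power: "poly_in n f \<Longrightarrow> poly_in n (f ^ k)"
  by (induction k) (auto intro: poly_in_mult)

lemma poly_in_sum: "(\<And>x. x \<in> A \<Longrightarrow> poly_in n (f x)) \<Longrightarrow> poly_in n (sum f A)"
  by (induction A rule: infinite_finite_induct) (auto intro: poly_in_add)

lemma poly_in_mono: "poly_in n f \<Longrightarrow> n \<le> n' \<Longrightarrow> poly_in n' f"
  unfolding poly_in_def by fastforce

lemma poly_in_dickson_eval:
  assumes "\<And>i. poly_in n (dickson n i :: 'p::prime_card fpoly)"
  shows "poly_in (Suc n) (dickson_eval n (PX n) :: 'p fpoly)"
  unfolding dickson_eval_def
  by (intro poly_in_sum poly_in_mult poly_in_power poly_in_PX poly_in_mono[OF assms]) simp_all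

lemma poly_in_dickson: "poly_in n (dickson n i :: 'p::prime_card fpoly)"
proof (induction n arbitrary: i)
  case (Suc n)
  have "poly_in (Suc n) (dickson n j :: 'p fpoly)" for j by (rule poly_in_mono[OF Suc.IH]) simp
  then show ?case unfolding dickson_Suc
    using poly_in_dickson_eval[OF Suc.IH]
    by (auto intro!: poly_in_diff poly_in_uminus poly_in_mult poly_in_power)
qed simp

lemma poly_in_Ln: "poly_in n (Ln n)"
proof (induction n)
  case 0
  then show ?case by (simp add: Ln_moore)
next
  case (Suc n)
  then show ?case unfolding Ln_Suc
    using poly_in_mono[of n "Ln n" "Suc n"]
    by (intro poly_in_mult poly_in_dickson_eval poly_in_dickson) simp_all
qed

lemma HBV_iff: "h \<in> HBV n \<longleftrightarrow> (\<forall>S. ext_coeff h S \<noteq> 0 \<longrightarrow> S \<subseteq> {0..<n} \<and> poly_in n (ext_coeff h S))"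
  by (simp add: HBV_def poly_in_def)

lemma HBV_add:
  assumes "g \<in> HBV n" "h \<in> HBV n"
  shows "g + h \<in> HBV n"
  unfolding HBV_iff plus_exterior.rep_eq
proof (intro allI impI conjI)
  fix S assume "ext_coeff g S + ext_coeff h S \<noteq> 0"
  then have "ext_coeff g S \<noteq> 0 \<or> ext_coeff h S \<noteq> 0" by auto
  then show "S \<subseteq> {0..<n}" using assms unfolding HBV_iff by blast
  \<comment> \<open>\<open>HBV\<close> constrains only nonzero coefficients, but the zero polynomial
    satisfies \<open>poly_in\<close> as well.\<close>
  have "poly_in n (ext_coeff g S)" "poly_in n (ext_coeff h S)"
    using assms unfolding HBV_iff by (metis poly_in_0)+
  then show "poly_in n (ext_coeff g S + ext_coeff h S)" by (rule poly_in_add)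
qed

lemma HBV_const: "poly_in n c \<Longrightarrow> ext_const c \<in> HBV n"
  by (auto simp: HBV_iff ext_const.rep_eq split: if_splits)

lemma HBV_gen: "i < n \<Longrightarrow> ext_gen i \<in> HBV n"
  by (auto simp: HBV_iff ext_gen.rep_eq split: if_splits)

lemma HBV_mult:
  assumes "g \<in> HBV n" "h \<in> HBV n"
  shows "g * h \<in> HBV n"
  unfolding HBV_iff times_exterior.rep_eq
proof (intro allI impI conjI)
  fix S
  let ?t = "\<lambda>T. ext_sign T (S - T) * ext_coeff g T * ext_coeff h (S - T)"
  have coeff: "poly_in n (ext_coeff g T)" "poly_in n (ext_coeff h T)" for T
    using assms unfolding HBV_iff by (metis poly_in_0)+
  have "poly_in n (ext_sign A B)" for A B
    using poly_in_of_int[of n "ext_sign A B"] by (simp add: ext_sign_def)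
  then show "poly_in n (\<Sum>T\<in>Pow S. ?t T)"
    by (intro poly_in_sum poly_in_mult coeff)
  assume "(\<Sum>T\<in>Pow S. ?t T) \<noteq> 0"
  then obtain T where "T \<subseteq> S" "?t T \<noteq> 0" by (metis (no_types, lifting) Pow_iff sum.neutral)
  then have "ext_coeff g T \<noteq> 0" "ext_coeff h (S - T) \<noteq> 0" by auto
  then have "T \<subseteq> {0..<n}" "S - T \<subseteq> {0..<n}" using assms unfolding HBV_iff by blast+
  then show "S \<subseteq> {0..<n}" by blast
qed

lemma HBV_0: "0 \<in> HBV n"
  using HBV_const[of n 0] by simp

lemma HBV_1: "1 \<in> HBV n"
  using HBV_const[of n 1] by simp

lemma HBV_of_int: "of_int k \<in> HBV n"
  using HBV_const[of n "of_int k"] by (simp add: ext_const_of_int)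

lemma HBV_sum: "(\<And>x. x \<in> A \<Longrightarrow> f x \<in> HBV n) \<Longrightarrow> sum f A \<in> HBV n"
  by (induction A rule: infinite_finite_induct) (auto intro: HBV_add HBV_0)

lemma HBV_prod_list: "(\<And>x. x \<in> set xs \<Longrightarrow> x \<in> HBV n) \<Longrightarrow> prod_list xs \<in> HBV n"
  by (induction xs) (auto intro: HBV_mult HBV_1)

lemma HBV_row_det:
  assumes "\<And>i j. i < n \<Longrightarrow> j < n \<Longrightarrow> a i j \<in> HBV n"
  shows "row_det n a \<in> HBV n"
  unfolding row_det_def
  by (intro HBV_sum HBV_mult HBV_of_int HBV_prod_list) (use assms in \<open>auto simp: permutes_in_image\<close>)

lemma HBV_Rn: "Rn n S \<in> HBV n"
  unfolding Rn_def Mn_def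
  by (intro HBV_mult HBV_const HBV_row_det poly_in_PC poly_in_power poly_in_Ln)
    (auto intro!: HBV_gen HBV_const poly_in_power poly_in_PX)

section \<open>Invariance of the generators under GL_n\<close>

lemma gl_act_ext_map:
  "gl_act A = ext_map (gl_poly A) (\<lambda>s. \<Sum>i = 0..<dim_row A. ext_const (PC (A $$ (i, s))) * ext_gen i)"
  by (rule ext) (simp add: gl_act_def ext_map_def ord_prod_def)

lemma ext_hom_gl_act:
  "ext_hom (gl_poly A) (\<lambda>s. \<Sum>i = 0..<dim_row A. ext_const (PC (A $$ (i, s))) * ext_gen i)"
  unfolding gl_poly_psubst
  by (intro ext_hom.intro comm_ring_hom_psubst anticommuting_linear[OF anticommuting_ext_gen]) simp

interpretation gl_act: Ring_Hom.ring_hom "gl_act A"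
  unfolding gl_act_ext_map by (rule ext_hom.ring_hom_ext_map[OF ext_hom_gl_act])

lemma gl_act_const: "gl_act A (ext_const f) = ext_const (gl_poly A f)"
  unfolding gl_act_ext_map by (rule ext_hom.ext_map_const[OF ext_hom_gl_act])

lemma gl_act_gen: "gl_act A (ext_gen s) = (\<Sum>i = 0..<dim_row A. ext_const (PC (A $$ (i, s))) * ext_gen i)"
  unfolding gl_act_ext_map by (rule ext_hom.ext_map_gen[OF ext_hom_gl_act])

lemma gl_poly_PC [simp]: "gl_poly A (PC c) = PC c"
  by (simp add: gl_poly_psubst)

lemma gl_poly_power: "gl_poly A (f ^ k) = gl_poly A f ^ k"
  by (simp add: gl_poly_psubst psubst.hom_power)

text \<open>Every row, whether it consists of the e_j or of powers of the x_j, transforms by the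
  same scalar matrix on the right, so \<open>row_det_mult\<close> extracts det A.\<close>

lemma gl_act_Mn:
  fixes A :: "'p::prime_card mod_ring mat"
  assumes A: "A \<in> carrier_mat n n"
  shows "gl_act A (Mn n S) = Mn n S * ext_const (PC (det A))"
proof -
  let ?r = "\<lambda>i. CARD('p) ^ (sorted_list_of_set ({0..<n} - S) ! (i - card S))"
  let ?a = "\<lambda>i j. if i < card S then ext_gen j else ext_const (PX j ^ ?r i) :: 'p fpoly exterior"
  have "row_det n (\<lambda>i j. gl_act A (?a i j)) =
      row_det n (\<lambda>i j. \<Sum>k = 0..<n. ?a i k * ext_const (PC (A $$ (k, j))))"
  proof (rule row_det_cong)
    fix i j assume "i < n" "j < n"
    show "gl_act A (?a i j) = (\<Sum>k = 0..<n. ?a i k * ext_const (PC (A $$ (k, j))))"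
    proof (cases "i < card S")
      case True
      then show ?thesis using A by (simp add: gl_act_gen ext_const_commute[of "ext_gen _"])
    next
      case False
      have "gl_poly A (PX j ^ ?r i) = (\<Sum>k = 0..<n. PX k ^ ?r i * PC (A $$ (k, j)))"
        using A by (simp add: gl_poly_psubst psubst.hom_power psubst_linear_power)
          (simp add: mult.commute)
      then show ?thesis using False by (simp add: gl_act_const ext_const_sum ext_const_mult)
    qed
  qed
  also have "\<dots> = row_det n ?a * ext_const (det (mat n n (\<lambda>(k, j). PC (A $$ (k, j)))))"
    by (rule row_det_mult)
  also have "mat n n (\<lambda>(k, j). PC (A $$ (k, j))) = map_mat PC A"
    using A by (intro eq_matI) auto
  finally show ?thesis
    by (simp add: Mn_def gl_act.hom_mult gl_act_const gl_act.hom_row_det mult.assoc)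
qed

text \<open>M contributes det A and the power of L_n contributes (det A)^(p-2); together they make
  (det A)^(p-1) = 1.\<close>

lemma gl_act_Rn:
  fixes A :: "'p::prime_card mod_ring mat"
  assumes A: "A \<in> carrier_mat n n" and inv: "invertible_mat A"
  shows "gl_act A (Rn n S) = Rn n S"
proof -
  let ?d = "det A"
  obtain k where k: "CARD('p) = Suc (Suc k)"
    using CARD_gt_1[where 'p = 'p] by (metis One_nat_def less_imp_Suc_add add_Suc)
  have "?d ^ CARD('p) = ?d"
    using finite_field_power_card_eq_same[of ?d] by simp
  then have "?d * ?d ^ k = 1"
    using invertible_mat_det_neq_0[OF A inv] unfolding k by simp
  then have *: "PC ?d * (PC ?d * Ln n) ^ k = (Ln n :: 'p fpoly) ^ k"
    by (simp add: power_mult_distrib mult.assoc[symmetric] flip: PC.hom_power PC_mult)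
  have "gl_act A (Rn n S) = Mn n S * (ext_const (PC ?d) * ext_const ((PC ?d * Ln n) ^ k))"
    using A by (simp add: Rn_def gl_act.hom_mult gl_act_Mn gl_act_const gl_poly_Ln k
        gl_poly_power mult.assoc)
  then show ?thesis unfolding ext_const_mult[symmetric] * by (simp add: Rn_def k)
qed

lemma gl_invariants_add: "g \<in> gl_invariants n \<Longrightarrow> h \<in> gl_invariants n \<Longrightarrow> g + h \<in> gl_invariants n"
  by (simp add: gl_invariants_def HBV_add gl_act.hom_add)

lemma gl_invariants_mult: "g \<in> gl_invariants n \<Longrightarrow> h \<in> gl_invariants n \<Longrightarrow> g * h \<in> gl_invariants n"
  by (simp add: gl_invariants_def HBV_mult gl_act.hom_mult)

lemma gl_invariants_const: "ext_const (PC c) \<in> gl_invariants n"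
  by (simp add: gl_invariants_def HBV_const gl_act_const)

lemma gl_invariants_Rn: "Rn n S \<in> gl_invariants n"
  by (simp add: gl_invariants_def HBV_Rn gl_act_Rn)

lemma gl_invariants_dickson: "i < n \<Longrightarrow> ext_const (dickson n i) \<in> gl_invariants n"
  by (simp add: gl_invariants_def HBV_const poly_in_dickson gl_act_const gl_poly_dickson)

lemma fp_scale_to_loc: "fp_scale c (to_loc h) = to_loc (ext_const (PC c) * h)"
  by (simp add: fp_scale_def to_loc.hom_mult)

lemma fp_subalgebra_invariants:
  "fp_subalgebra (to_loc ` gl_invariants n :: 'p::prime_card fpoly fract exterior set)"
  unfolding fp_subalgebra_def fp.subspace_def
proof (intro conjI ballI allI)
  show "0 \<in> to_loc ` gl_invariants n"
    using gl_invariants_const[of 0 n] by (intro image_eqI[of _ _ 0]) simp_all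
  show "1 \<in> to_loc ` gl_invariants n"
    using gl_invariants_const[of 1 n] by (intro image_eqI[of _ _ 1]) simp_all
  fix x y :: "'p fpoly fract exterior"
  assume "x \<in> to_loc ` gl_invariants n" "y \<in> to_loc ` gl_invariants n"
  then obtain g h where "x = to_loc g" "y = to_loc h" "g \<in> gl_invariants n" "h \<in> gl_invariants n"
    by auto
  then have "x + y = to_loc (g + h)" "x * y = to_loc (g * h)"
    "g + h \<in> gl_invariants n" "g * h \<in> gl_invariants n"
    by (simp_all add: to_loc.hom_add to_loc.hom_mult gl_invariants_add gl_invariants_mult)
  then show "x + y \<in> to_loc ` gl_invariants n" "x * y \<in> to_loc ` gl_invariants n" by blast+
next
  fix c and x :: "'p fpoly fract exterior" assume "x \<in> to_loc ` gl_invariants n"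
  then obtain h where "x = to_loc h" "h \<in> gl_invariants n" by auto
  then show "fp_scale c x \<in> to_loc ` gl_invariants n"
    by (auto simp: fp_scale_to_loc intro!: imageI gl_invariants_mult gl_invariants_const)
qed

text \<open>Turns signs into scalars of the prime field, so that every subspace absorbs
  them.\<close>

lemma of_int_mult_fp_scale: "of_int k * x = fp_scale (of_int k) x"
  by (simp add: fp_scale_def PC.hom_of_int to_fract.hom_of_int ext_const_of_int)

text \<open>Together with \<open>fp_subalgebra_invariants\<close> it makes the ring of invariants a
  member of the family intersected in \<open>Bn\<close>, which is therefore nonempty.\<close>

lemma Bn_gens_invariant: "Bn_gens n \<subseteq> (to_loc ` gl_invariants n :: 'p::prime_card fpoly fract exterior set)"
proof -
  have "ext_const (qni n i) \<in> (to_loc ` gl_invariants n :: 'p fpoly fract exterior set)" if i: "i < n" for i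
  proof -
    obtain u :: int where u: "qni n i = to_fract (of_int u * dickson n i :: 'p fpoly)"
      using qni_dickson[OF i] .
    have "ext_const (qni n i) = to_loc (ext_const (PC (of_int u)) * ext_const (dickson n i :: 'p fpoly))"
      by (simp add: u PC.hom_of_int flip: ext_const_mult)
    then show ?thesis
      using gl_invariants_mult[OF gl_invariants_const gl_invariants_dickson[OF i]] by blast
  qed
  then show ?thesis using gl_invariants_Rn by (auto simp: Bn_gens_def)
qed

section \<open>Normal forms\<close>

text \<open>Up to sign, \<open>R\<^bsub>n;s\<^esub>\<close> is \<open>q\<^bsub>n,0\<^esub>\<close> times \<open>dual_gen n s\<close>. Absorbing these powers of \<open>q\<^bsub>n,0\<^esub>\<close>
  into \<open>q\<^sup>I\<close> makes all exponents nonnegative, and \<open>2 i\<^sub>1 + b(I) \<ge> 0\<close> becomes \<open>|S| \<le> 2 m\<^sub>1\<close>.\<close>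

definition norm_form :: "nat \<Rightarrow> nat set \<times> (nat \<Rightarrow> nat) \<Rightarrow> 'p::prime_card fpoly fract exterior" where
  "norm_form n = (\<lambda>(S, m). ext_const (\<Prod>s<n. qni n s ^ m s) * ord_prod (dual_gen n) S)"

definition norm_index :: "nat \<Rightarrow> (nat set \<times> (nat \<Rightarrow> nat)) set" where
  "norm_index n = {(S, m). S \<subseteq> {0..<n} \<and> (\<forall>s\<ge>n. m s = 0) \<and> card S \<le> 2 * m 0}"

definition to_norm :: "(nat \<Rightarrow> nat) \<times> (nat \<Rightarrow> int) \<Rightarrow> nat set \<times> (nat \<Rightarrow> nat)" where
  "to_norm = (\<lambda>(\<epsilon>, i). let S = {s. \<epsilon> s = 1} in (S, \<lambda>s. nat (i s + (if s = 0 then int (card S) else 0))))"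

lemma admissible_supp:
  assumes "(\<epsilon>, i) \<in> admissible n"
  shows "{s. \<epsilon> s = 1} \<subseteq> {0..<n}" "(\<Sum>s = 0..<n. \<epsilon> s) = card {s. \<epsilon> s = 1}"
proof -
  have \<epsilon>: "\<forall>s<n. \<epsilon> s \<in> {0, 1}" "\<forall>s\<ge>n. \<epsilon> s = 0" using assms by (auto simp: admissible_def)
  then show *: "{s. \<epsilon> s = 1} \<subseteq> {0..<n}" by (force simp: not_less[symmetric])
  have "(\<Sum>s = 0..<n. \<epsilon> s) = (\<Sum>s = 0..<n. if \<epsilon> s = 1 then 1 else 0)"
    using \<epsilon>(1) by (intro sum.cong) auto
  also have "\<dots> = card {s. \<epsilon> s = 1}"
    using Int_absorb1[OF *] by (simp add: sum.If_cases)
  finally show "(\<Sum>s = 0..<n. \<epsilon> s) = card {s. \<epsilon> s = 1}" .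
qed

text \<open>At index 0, twice the sum is (2 i_1 + b(I)) + b(I), with both summands nonnegative.
  Hence \<open>nat\<close> in \<open>to_norm\<close> loses nothing on admissible indices.\<close>

lemma admissible_nonneg:
  assumes "(\<epsilon>, i) \<in> admissible n"
  shows "i s + (if s = 0 then int (card {s. \<epsilon> s = 1}) else 0) \<ge> 0"
proof -
  have "i s \<ge> 0" if "s \<noteq> 0" using assms that by (cases "s < n") (auto simp: admissible_def)
  moreover have "2 * i 0 + int (card {s. \<epsilon> s = 1}) \<ge> 0"
    using assms admissible_supp(2)[OF assms] by (auto simp: admissible_def simp del: of_nat_sum)
  ultimately show ?thesis by auto
qed

lemma to_norm_inj: "inj_on to_norm (admissible n)"
proof (rule inj_onI, clarify)
  fix \<epsilon> i \<epsilon>' i'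
  assume *: "(\<epsilon>, i) \<in> admissible n" "(\<epsilon>', i') \<in> admissible n" "to_norm (\<epsilon>, i) = to_norm (\<epsilon>', i')"
  then have S: "{s. \<epsilon> s = 1} = {s. \<epsilon>' s = 1}" by (simp add: to_norm_def Let_def)
  have "i s = i' s" for s
  proof -
    have "nat (i s + (if s = 0 then int (card {s. \<epsilon> s = 1}) else 0)) =
        nat (i' s + (if s = 0 then int (card {s. \<epsilon>' s = 1}) else 0))"
      using arg_cong[OF *(3), of "\<lambda>x. snd x s"] by (simp only: to_norm_def prod.case Let_def snd_conv)
    then show ?thesis
      using admissible_nonneg[OF *(1), of s] admissible_nonneg[OF *(2), of s] S
      by (simp only: eq_nat_nat_iff)
  qed
  moreover have "\<epsilon> s = \<epsilon>' s" for s
  proof -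
    have "\<epsilon> s \<in> {0, 1}" "\<epsilon>' s \<in> {0, 1}" using *(1,2) by (cases "s < n"; simp add: admissible_def)+
    moreover have "\<epsilon> s = 1 \<longleftrightarrow> \<epsilon>' s = 1" using S by blast
    ultimately show ?thesis by auto
  qed
  ultimately show "\<epsilon> = \<epsilon>' \<and> i = i'" by auto
qed

lemma to_norm_image: "n \<ge> 1 \<Longrightarrow> to_norm ` admissible n = norm_index n"
proof (intro equalityI subsetI)
  fix x assume "x \<in> to_norm ` admissible n"
  then obtain \<epsilon> i where x: "x = to_norm (\<epsilon>, i)" "(\<epsilon>, i) \<in> admissible n" by auto
  have "2 * i 0 + int (card {s. \<epsilon> s = 1}) \<ge> 0" "\<forall>s\<ge>n. i s = 0"
    using x(2) admissible_supp(2)[OF x(2)] by (auto simp: admissible_def simp del: of_nat_sum)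
  moreover assume "n \<ge> 1"
  ultimately show "x \<in> norm_index n"
    using admissible_supp(1)[OF x(2)] by (auto simp: x(1) to_norm_def norm_index_def Let_def)
next
  fix x assume "n \<ge> 1" "x \<in> norm_index n"
  then obtain S m where x: "x = (S, m)" "S \<subseteq> {0..<n}" "\<forall>s\<ge>n. m s = 0" "card S \<le> 2 * m 0"
    by (auto simp: norm_index_def)
  let ?\<epsilon> = "\<lambda>s. if s \<in> S then 1 else 0 :: nat"
  \<comment> \<open>Undoes the shift of \<open>to_norm\<close>; \<open>card S\<close> \<le> 2
    \<open>m 0\<close> says precisely that 2 (\<open>m 0\<close> - \<open>card S\<close>) +
    \<open>card S\<close> \<ge> 0.\<close>
  let ?i = "\<lambda>s. int (m s) - (if s = 0 then int (card S) else 0)"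
  have S: "{s. ?\<epsilon> s = 1} = S" by auto
  have "(\<Sum>s = 0..<n. ?\<epsilon> s) = card S"
    using x(2) by (simp add: sum.If_cases Int_absorb1)
  then have "(?\<epsilon>, ?i) \<in> admissible n"
    using x \<open>n \<ge> 1\<close> by (auto simp: admissible_def simp del: of_nat_sum)
  moreover have "to_norm (?\<epsilon>, ?i) = x" unfolding to_norm_def prod.case S by (auto simp: x(1) Let_def)
  ultimately show "x \<in> to_norm ` admissible n" by blast
qed

lemma qni_neq_0: "s < n \<Longrightarrow> qni n s \<noteq> (0 :: 'p::prime_card fpoly fract)"
proof -
  assume s: "s < n"
  obtain u :: int where "u \<in> {1, -1}" "qni n s = to_fract (of_int u * dickson n s :: 'p fpoly)"
    using qni_dickson[OF s] .
  then show ?thesis using dickson_neq_0[OF s, where 'p = 'p] by auto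
qed

lemma Rn_dual_gen:
  assumes "s < n"
  obtains u :: int where "u \<in> {1, -1}"
    "to_loc (Rn n {s}) = of_int u * (ext_const (qni n 0) * dual_gen n s :: 'p::prime_card fpoly fract exterior)"
proof -
  obtain u :: int where u: "u \<in> {1, -1}"
    "to_loc (Rn n {s}) = ext_const (to_fract (of_int u * Ln n ^ (CARD('p) - 1))) *
      (dual_gen n s :: 'p fpoly fract exterior)"
    using to_loc_Rn_single[OF assms] .
  then show ?thesis
    by (intro that[OF u(1)])
      (simp add: qni_0 ext_const_mult to_fract.hom_mult to_fract.hom_of_int ext_const_of_int mult.assoc)
qed

lemma Rn_pair_dual_gen:
  assumes "s < t" "t < n" "odd CARD('p)"
  obtains u :: int where "u \<in> {1, -1}"
    "to_loc (Rn n {s, t}) = of_int u *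
      (ext_const (qni n 0) * (dual_gen n s * dual_gen n t) :: 'p::prime_card fpoly fract exterior)"
proof -
  obtain u :: int where u: "u \<in> {1, -1}"
    "to_loc (Rn n {s, t}) = ext_const (to_fract (of_int u * Ln n ^ (CARD('p) - 1))) *
      (dual_gen n s * dual_gen n t :: 'p fpoly fract exterior)"
    using to_loc_Rn_pair[OF assms] .
  then show ?thesis
    by (intro that[OF u(1)])
      (simp add: qni_0 ext_const_mult to_fract.hom_mult to_fract.hom_of_int ext_const_of_int mult.assoc)
qed

text \<open>Each R_{n;s} is up to sign the central q_{n,0} times f_s, so the scalars collect in
  front while the f_s keep their order.\<close>

lemma prod_list_Rn:
  assumes "set xs \<subseteq> {0..<n}" "\<forall>s\<in>set xs. \<epsilon> s \<in> {0, 1 :: nat}"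
  shows "\<exists>u\<in>{1, -1 :: int}. prod_list (map (\<lambda>s. to_loc (Rn n {s}) ^ \<epsilon> s) xs) =
    of_int u * (ext_const (qni n 0 ^ length (filter (\<lambda>s. \<epsilon> s = 1) xs)) *
      (prod_list (map (dual_gen n) (filter (\<lambda>s. \<epsilon> s = 1) xs)) :: 'p::prime_card fpoly fract exterior))"
  using assms
proof (induction xs)
  case (Cons x xs)
  let ?ys = "filter (\<lambda>s. \<epsilon> s = 1) xs"
  let ?P = "prod_list (map (dual_gen n) ?ys) :: 'p fpoly fract exterior"
  have "\<exists>u\<in>{1, -1 :: int}. prod_list (map (\<lambda>s. to_loc (Rn n {s}) ^ \<epsilon> s) xs) =
      of_int u * (ext_const (qni n 0 ^ length ?ys) * ?P)"
    by (rule Cons.IH) (use Cons.prems in auto)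
  then obtain u where u: "u \<in> {1, -1 :: int}" "prod_list (map (\<lambda>s. to_loc (Rn n {s}) ^ \<epsilon> s) xs) =
      of_int u * (ext_const (qni n 0 ^ length ?ys) * ?P)"
    by blast
  show ?case
  proof (cases "\<epsilon> x = 1")
    case True
    have "x < n" using Cons.prems by simp
    then obtain v :: int where v: "v \<in> {1, -1}"
      "to_loc (Rn n {x}) = of_int v * (ext_const (qni n 0) * dual_gen n x :: 'p fpoly fract exterior)"
      by (rule Rn_dual_gen)
    have "prod_list (map (\<lambda>s. to_loc (Rn n {s}) ^ \<epsilon> s) (x # xs)) =
        of_int v * (ext_const (qni n 0) * dual_gen n x) * (of_int u * (ext_const (qni n 0 ^ length ?ys) * ?P))"
      using True u v by simp
    also have "\<dots> = of_int (v * u) * (ext_const (qni n 0 ^ Suc (length ?ys)) * (dual_gen n x * ?P))"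
      using u(1) v(1) by (auto simp: ext_const_mult mult.assoc ext_const_left_commute[of "dual_gen n x"])
    finally show ?thesis using True u(1) v(1) by (intro bexI[of _ "v * u"]) auto
  next
    case False
    then show ?thesis using u Cons.prems by auto
  qed
qed auto

lemma qI_norm_form:
  assumes I: "I \<in> admissible n" and n: "n \<ge> 1"
  obtains u :: int where "u \<in> {1, -1}"
    "qI n I = fp_scale (of_int u) (norm_form n (to_norm I) :: 'p::prime_card fpoly fract exterior)"
proof -
  obtain \<epsilon> i where I_eq: "I = (\<epsilon>, i)" by (cases I)
  note adm = I[unfolded I_eq]
  let ?S = "{s. \<epsilon> s = 1}"
  let ?q = "qni n :: nat \<Rightarrow> 'p fpoly fract"
  \<comment> \<open>The factors of q^I already come in increasing order, so no reordering sign
    arises against \<open>ord_prod\<close>.\<close>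
  have "filter (\<lambda>s. \<epsilon> s = 1) [0..<n] = sorted_list_of_set (set (filter (\<lambda>s. \<epsilon> s = 1) [0..<n]))"
    by (rule sym, rule sorted_list_of_set.idem_if_sorted_distinct) (auto intro: sorted_wrt_filter)
  also have "set (filter (\<lambda>s. \<epsilon> s = 1) [0..<n]) = ?S"
    using admissible_supp(1)[OF adm] by auto
  finally have filter: "filter (\<lambda>s. \<epsilon> s = 1) [0..<n] = sorted_list_of_set ?S" .
  have "\<exists>u\<in>{1, -1 :: int}. prod_list (map (\<lambda>s. to_loc (Rn n {s}) ^ \<epsilon> s) [0..<n]) =
      of_int u * (ext_const (?q 0 ^ card ?S) * ord_prod (dual_gen n) ?S)"
    using prod_list_Rn[of "[0..<n]" n \<epsilon>, where 'p = 'p] adm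
    unfolding filter by (simp add: admissible_def ord_prod_def)
  then obtain u where u: "u \<in> {1, -1 :: int}"
    "prod_list (map (\<lambda>s. to_loc (Rn n {s}) ^ \<epsilon> s) [0..<n]) =
      of_int u * (ext_const (?q 0 ^ card ?S) * ord_prod (dual_gen n) ?S)"
    by blast
  \<comment> \<open>The powers of q_{n,0} released by the R's meet the possibly negative exponent at
    index 0; as q_{n,0} is nonzero in the fraction field, exponents add and the total is
    nonnegative.\<close>
  have "?q 0 ^ card ?S * prod_list (map (\<lambda>s. ?q s powi i s) [0..<n]) =
      (\<Prod>s<n. ?q s ^ nat (i s + (if s = 0 then int (card ?S) else 0)))"
  proof -
    have "prod_list (map (\<lambda>s. ?q s powi i s) [0..<n]) = (\<Prod>s<n. ?q s powi i s)"
      using prod.distinct_set_conv_list[of "[0..<n]" "\<lambda>s. ?q s powi i s"] by (simp add: lessThan_atLeast0)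
    moreover have "?q 0 ^ card ?S = (\<Prod>s<n. ?q s powi (if s = 0 then int (card ?S) else 0))"
      using n by (subst prod.remove[of _ 0]) auto
    moreover have "?q s powi (if s = 0 then int (card ?S) else 0) * ?q s powi i s =
        ?q s ^ nat (i s + (if s = 0 then int (card ?S) else 0))" if "s < n" for s
    proof -
      have "?q s powi (i s + (if s = 0 then int (card ?S) else 0)) =
          ?q s powi i s * ?q s powi (if s = 0 then int (card ?S) else 0)"
        by (rule power_int_add) (use qni_neq_0[OF that] in blast)
      moreover have "?q s powi (i s + (if s = 0 then int (card ?S) else 0)) =
          ?q s ^ nat (i s + (if s = 0 then int (card ?S) else 0))"
        using admissible_nonneg[OF adm, of s] by (simp only: power_int_def if_True)
      ultimately show ?thesis by (simp only: mult.commute)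
    qed
    ultimately show ?thesis by (simp add: prod.distrib[symmetric] del: prod.distrib)
  qed
  moreover have "qI n I = of_int u * (ext_const (?q 0 ^ card ?S) * ord_prod (dual_gen n) ?S) *
      ext_const (prod_list (map (\<lambda>s. ?q s powi i s) [0..<n]))"
    by (simp only: I_eq qI_def prod.case prod_list_mult_const u(2))
  then have "qI n I = of_int u * (ext_const (?q 0 ^ card ?S * prod_list (map (\<lambda>s. ?q s powi i s) [0..<n])) *
      ord_prod (dual_gen n) ?S)"
    by (simp only: mult.assoc ext_const_mult ext_const_commute[of "ord_prod _ _"])
  ultimately have "qI n I = of_int u * (norm_form n (to_norm I) :: 'p fpoly fract exterior)"
    by (simp only: I_eq norm_form_def to_norm_def prod.case Let_def)
  then show ?thesis using that[OF u(1)] by (simp only: of_int_mult_fp_scale)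
qed

section \<open>Linear independence\<close>

text \<open>Lets the exponent vectors be attached to arbitrary indices, here needed for the pairs
  (S, m) behind the elements q^I.\<close>

lemma dickson_independent_family:
  fixes c :: "'i \<Rightarrow> 'p::prime_card mod_ring"
  assumes F: "finite F" and inj: "inj_on g F" and g: "\<And>x s. x \<in> F \<Longrightarrow> s \<ge> n \<Longrightarrow> g x s = 0"
    and sum: "(\<Sum>x\<in>F. PC (c x) * (\<Prod>s<n. dickson n s ^ g x s)) = 0" and x: "x \<in> F"
  shows "c x = 0"
proof -
  let ?h = "the_inv_into F g"
  have h: "?h (g y) = y" if "y \<in> F" for y using the_inv_into_f_f[OF inj that] .
  have "c (?h (g x)) = 0"
  proof (rule dickson_algebraically_independent[of "g ` F" n "\<lambda>m. c (?h m)"])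
    show "(\<Sum>m\<in>g ` F. PC (c (?h m)) * (\<Prod>s<n. dickson n s ^ m s)) = 0"
      using sum by (simp add: sum.reindex[OF inj] h)
  qed (use F g x in auto)
  then show ?thesis using h[OF x] by simp
qed

text \<open>\<open>moore_map\<close> turns the f_S into the monomials e_S. The coefficient at a
  fixed e_S is then a relation among Dickson polynomials over the prime field.\<close>

lemma norm_form_independent_family:
  fixes c :: "'i \<Rightarrow> 'p::prime_card mod_ring"
  assumes F: "finite F" and inj: "inj_on g F" and g: "g ` F \<subseteq> norm_index n"
    and sum: "(\<Sum>x\<in>F. fp_scale (c x) (norm_form n (g x))) = 0" and x0: "x0 \<in> F"
  shows "c x0 = 0"
proof -
  have "\<forall>s<n. \<exists>u\<in>{1, -1 :: int}. qni n s = to_fract (of_int u * dickson n s :: 'p fpoly)"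
    using qni_dickson[where 'p = 'p, of _ n] by metis
  then obtain u :: "nat \<Rightarrow> int" where u: "\<And>s. s < n \<Longrightarrow> u s \<in> {1, -1}"
    "\<And>s. s < n \<Longrightarrow> qni n s = to_fract (of_int (u s) * dickson n s :: 'p fpoly)"
    by metis
  let ?S = "\<lambda>x. fst (g x)" and ?m = "\<lambda>x. snd (g x)"
  have S: "?S x \<subseteq> {0..<n}" "finite (?S x)" "\<And>s. s \<ge> n \<Longrightarrow> ?m x s = 0" if "x \<in> F" for x
  proof -
    have "g x \<in> norm_index n" using g that by blast
    then show "?S x \<subseteq> {0..<n}" "\<And>s. s \<ge> n \<Longrightarrow> ?m x s = 0" by (auto simp: norm_index_def)
    then show "finite (?S x)" using finite_subset by blast
  qed
  \<comment> \<open>The signs between q_{n,s} and \<open>dickson n s\<close>, moved into the scalar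
    coefficient; the product is a unit.\<close>
  let ?v = "\<lambda>x. \<Prod>s<n. of_int (u s) ^ ?m x s :: 'p mod_ring"
  let ?d = "\<lambda>x. PC (c x * ?v x) * (\<Prod>s<n. dickson n s ^ ?m x s) :: 'p fpoly"
  have coeff: "to_fract (PC (c x)) * (\<Prod>s<n. qni n s ^ ?m x s) = to_fract (?d x)" for x
  proof -
    have "(\<Prod>s<n. qni n s ^ ?m x s) = (\<Prod>s<n. to_fract (of_int (u s) ^ ?m x s * dickson n s ^ ?m x s :: 'p fpoly))"
      by (intro prod.cong) (simp_all add: u(2) power_mult_distrib to_fract.hom_power)
    also have "\<dots> = to_fract (PC (?v x) * (\<Prod>s<n. dickson n s ^ ?m x s))"
      by (simp add: PC.hom_prod PC.hom_power PC.hom_of_int to_fract.hom_prod prod.distrib)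
    finally show ?thesis by (simp add: PC_mult mult.assoc)
  qed
  have "0 = moore_map n (\<Sum>x\<in>F. fp_scale (c x) (norm_form n (g x)))"
    unfolding sum using moore_map_const[of n 0] by simp
  also have "\<dots> = (\<Sum>x\<in>F. ext_const (to_fract (?d x)) * ord_prod ext_gen (?S x))"
    unfolding moore_map_sum
  proof (rule sum.cong[OF refl])
    fix x assume "x \<in> F"
    then have "moore_map n (ord_prod (dual_gen n) (?S x)) =
        (ord_prod ext_gen (?S x) :: 'p fpoly fract exterior)"
      by (intro moore_map_ord_prod_dual_gen S)
    then show "moore_map n (fp_scale (c x) (norm_form n (g x))) =
        ext_const (to_fract (?d x)) * ord_prod ext_gen (?S x)"
      unfolding coeff[symmetric]
      by (simp add: fp_scale_def norm_form_def case_prod_unfold moore_map_mult ext_const_mult mult.assoc)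
  qed
  finally have zero: "0 = (\<Sum>x\<in>F. ext_const (to_fract (?d x)) * ord_prod ext_gen (?S x))" .
  have "ext_coeff (\<Sum>x\<in>F. ext_const (to_fract (?d x)) * ord_prod ext_gen (?S x)) (?S x0) = 0"
    by (simp only: zero[symmetric] zero_exterior.rep_eq)
  then have "0 = (\<Sum>x\<in>F. to_fract (?d x) * (if ?S x0 = ?S x then 1 else 0))"
    using S(2) by (simp only: ext_coeff_sum ext_coeff_const_mult ext_coeff_monomial cong: sum.cong)
  also have "\<dots> = to_fract (\<Sum>x\<in>{x\<in>F. ?S x = ?S x0}. ?d x)"
    unfolding to_fract_sum by (rule sum.mono_neutral_cong_right) (use F in auto)
  finally have "to_fract (\<Sum>x\<in>{x\<in>F. ?S x = ?S x0}. ?d x) = 0" by (rule sym)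
  then have "(\<Sum>x\<in>{x\<in>F. ?S x = ?S x0}. ?d x) = 0" by (rule to_fract_eq_0_iff[THEN iffD1])
  then have "c x0 * ?v x0 = 0"
  proof (rule dickson_independent_family[rotated 3])
    \<comment> \<open>On indices sharing the same S, the exponent vector alone determines the
      index.\<close>
    show "inj_on ?m {x\<in>F. ?S x = ?S x0}"
      using inj by (auto simp: inj_on_def prod_eq_iff)
  qed (use F S x0 in auto)
  moreover have "?v x0 \<noteq> 0" using u(1) by (subst prod_zero_iff) force+
  ultimately show ?thesis by simp
qed

text \<open>Independence of the indexed family also yields injectivity: v x = v y with distinct x
  and y would be a relation with coefficients 1 and -1.\<close>

lemma (in vector_space) independent_familyI:
  assumes "\<And>F c x. finite F \<Longrightarrow> F \<subseteq> A \<Longrightarrow> (\<Sum>x\<in>F. scale (c x) (v x)) = 0 \<Longrightarrow> x \<in> F \<Longrightarrow> c x = 0"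
  shows "inj_on v A \<and> independent (v ` A)"
proof
  show inj: "inj_on v A"
  proof (rule inj_onI, rule ccontr)
    fix x y assume xy: "x \<in> A" "y \<in> A" "v x = v y" "x \<noteq> y"
    have "(\<Sum>z\<in>{x, y}. scale (if z = x then 1 else - 1) (v z)) = 0"
      using xy by simp
    from assms[OF _ _ this, of x] xy show False by simp
  qed
  show "independent (v ` A)"
    unfolding independent_explicit_finite_subsets
  proof (intro allI impI ballI)
    fix S c w assume S: "S \<subseteq> v ` A" "finite S" "(\<Sum>x\<in>S. scale (c x) x) = 0" "w \<in> S"
    obtain F where F: "F \<subseteq> A" "finite F" "S = v ` F" using finite_subset_image[OF S(2,1)] by auto
    have "inj_on v F" using inj F(1) by (rule inj_on_subset)
    then have "(\<Sum>x\<in>F. scale (c (v x)) (v x)) = 0" using S(3) by (simp add: F(3) sum.reindex)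
    then show "c w = 0" using assms[of F "\<lambda>x. c (v x)"] F S(4) by blast
  qed
qed

lemma qI_independent:
  assumes "n \<ge> 1"
  shows "inj_on (qI n :: _ \<Rightarrow> 'p::prime_card fpoly fract exterior) (admissible n) \<and>
    fp.independent (qI n ` admissible n :: 'p fpoly fract exterior set)"
proof (rule fp.independent_familyI)
  fix F c I
  assume F: "finite F" "F \<subseteq> admissible n" "I \<in> F"
    and sum: "(\<Sum>I\<in>F. fp_scale (c I) (qI n I :: 'p fpoly fract exterior)) = 0"
  have "\<forall>I\<in>F. \<exists>u\<in>{1, -1 :: int}. qI n I =
      fp_scale (of_int u) (norm_form n (to_norm I) :: 'p fpoly fract exterior)"
    using qI_norm_form[OF _ assms, where 'p = 'p] F(2) by (metis subsetD)
  then obtain u :: "_ \<Rightarrow> int" where u: "\<And>I. I \<in> F \<Longrightarrow> u I \<in> {1, -1}"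
    "\<And>I. I \<in> F \<Longrightarrow> qI n I = fp_scale (of_int (u I)) (norm_form n (to_norm I) :: 'p fpoly fract exterior)"
    by metis
  have "(\<Sum>I\<in>F. fp_scale (c I * of_int (u I)) (norm_form n (to_norm I) :: 'p fpoly fract exterior)) = 0"
    using sum by (simp add: u(2) cong: sum.cong)
  then have "c I * of_int (u I) = 0"
    by (rule norm_form_independent_family[rotated 3])
      (use F inj_on_subset[OF to_norm_inj F(2)] to_norm_image[OF assms] in auto)
  then show "c I = 0" using u(1)[OF F(3)] by auto
qed

section \<open>The span\<close>

text \<open>The two families correspond under \<open>to_norm\<close> up to signs, and a sign is its
  own inverse.\<close>

lemma span_qI:
  assumes "n \<ge> 1"
  shows "fp.span (qI n ` admissible n) =
    (fp.span (norm_form n ` norm_index n) :: 'p::prime_card fpoly fract exterior set)"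
proof (rule subset_antisym)
  show "fp.span (qI n ` admissible n) \<subseteq>
    (fp.span (norm_form n ` norm_index n) :: 'p fpoly fract exterior set)"
  proof (rule fp.span_minimal[OF _ fp.subspace_span], clarify)
    fix \<epsilon> i assume I: "(\<epsilon>, i) \<in> admissible n"
    obtain u where "qI n (\<epsilon>, i) =
        fp_scale (of_int u) (norm_form n (to_norm (\<epsilon>, i)) :: 'p fpoly fract exterior)"
      using qI_norm_form[OF I assms] by metis
    moreover have "to_norm (\<epsilon>, i) \<in> norm_index n" using I to_norm_image[OF assms] by blast
    ultimately show "qI n (\<epsilon>, i) \<in> (fp.span (norm_form n ` norm_index n) :: 'p fpoly fract exterior set)"
      by (simp add: fp.span_scale fp.span_base)
  qed
  show "fp.span (norm_form n ` norm_index n) \<subseteq>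
    (fp.span (qI n ` admissible n) :: 'p fpoly fract exterior set)"
  proof (rule fp.span_minimal[OF _ fp.subspace_span], rule image_subsetI)
    fix x assume "x \<in> norm_index n"
    then obtain I where I: "I \<in> admissible n" "x = to_norm I" using to_norm_image[OF assms] by blast
    obtain u :: int where u: "u \<in> {1, -1}"
      "qI n I = fp_scale (of_int u) (norm_form n (to_norm I) :: 'p fpoly fract exterior)"
      using qI_norm_form[OF I(1) assms] .
    have "norm_form n x = fp_scale (of_int u) (qI n I :: 'p fpoly fract exterior)"
      using u(1) by (auto simp: u(2) I(2))
    then show "norm_form n x \<in> (fp.span (qI n ` admissible n) :: 'p fpoly fract exterior set)"
      using I(1) by (simp add: fp.span_scale fp.span_base)
  qed
qed

section \<open>Closure of the normal forms under multiplication\<close>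

lemma norm_form_mult:
  fixes S T :: "nat set"
  assumes "finite S" "finite T"
  shows "norm_form n (S, m) * norm_form n (T, k) = (if S \<inter> T = {}
    then fp_scale ((- 1) ^ inversions S T) (norm_form n (S \<union> T, \<lambda>s. m s + k s)) else 0 :: 'p::prime_card fpoly fract exterior)"
proof -
  interpret anticommuting "dual_gen n :: nat \<Rightarrow> 'p fpoly fract exterior"
    by (rule anticommuting_dual_gen)
  let ?q = "\<lambda>m. \<Prod>s<n. qni n s ^ m s :: 'p fpoly fract"
  have "norm_form n (S, m) * norm_form n (T, k) =
      ext_const (?q m * ?q k) * (ord_prod (dual_gen n) S * ord_prod (dual_gen n) T)"
    by (simp add: norm_form_def ext_const_mult mult.assoc ext_const_left_commute[of "ord_prod _ _"])
  also have "?q m * ?q k = ?q (\<lambda>s. m s + k s)"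
    by (simp add: prod.distrib power_add)
  finally have prod: "norm_form n (S, m) * norm_form n (T, k) =
      ext_const (?q (\<lambda>s. m s + k s)) * (ord_prod (dual_gen n) S * ord_prod (dual_gen n) T)" .
  have sgn: "((- 1) ^ j :: 'p fpoly fract exterior) = ext_const ((- 1) ^ j)" for j
    by (simp add: ext_const_power)
  have "to_fract (PC ((- 1) ^ j)) = ((- 1) ^ j :: 'p fpoly fract)" for j
    by (simp add: PC.hom_power PC.hom_uminus to_fract.hom_power)
  then show ?thesis
    unfolding prod ord_prod_mult[OF assms] sgn
    by (simp add: norm_form_def fp_scale_def)
      (simp add: mult.assoc[symmetric] ext_const_mult[symmetric] mult.commute)
qed

text \<open>Bilinearity, by span induction in one argument at a time.\<close>

lemma span_mult_closed:
  assumes "\<And>x y. x \<in> B \<Longrightarrow> y \<in> B \<Longrightarrow> x * y \<in> fp.span B" "x \<in> fp.span B" "y \<in> fp.span B"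
  shows "x * y \<in> fp.span B"
proof -
  have scale: "fp_scale c a * b = fp_scale c (a * b)" "a * fp_scale c b = fp_scale c (a * b)"
    for c and a b :: "'a fpoly fract exterior"
    by (simp_all add: fp_scale_def mult.assoc ext_const_left_commute[of a])
  have left: "a * y \<in> fp.span B" if "a \<in> B" for a
    using assms(3)
    by (induction rule: fp.span_induct_alt)
      (auto simp: distrib_left scale fp.span_zero intro!: fp.span_add fp.span_scale assms(1) that)
  show ?thesis
    using assms(2)
    by (induction rule: fp.span_induct_alt)
      (auto simp: distrib_right scale fp.span_zero intro!: fp.span_add fp.span_scale left)
qed

text \<open>Exponents add while index sets unite, and \<open>card (S \<union> T)\<close> is at most
  \<open>card S + card T\<close>, so the bound in \<open>norm_index\<close> is preserved.\<close>

lemma fp_subalgebra_span_norm_form: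
  "fp_subalgebra (fp.span (norm_form n ` norm_index n :: 'p::prime_card fpoly fract exterior set))"
  unfolding fp_subalgebra_def
proof (intro conjI ballI)
  let ?V = "fp.span (norm_form n ` norm_index n :: 'p fpoly fract exterior set)"
  have "norm_form n ({}, \<lambda>_. 0) \<in> ?V" by (intro fp.span_base imageI) (simp add: norm_index_def)
  then show "1 \<in> ?V" by (simp add: norm_form_def)
  fix x y assume xy: "x \<in> ?V" "y \<in> ?V"
  show "x * y \<in> ?V"
  proof (rule span_mult_closed[OF _ xy], clarify)
    fix S m T k assume *: "(S, m) \<in> norm_index n" "(T, k) \<in> norm_index n"
    then have "finite S" "finite T" by (auto simp: norm_index_def intro: finite_subset)
    moreover have "(S \<union> T, \<lambda>s. m s + k s) \<in> norm_index n"
      using * card_Un_le[of S T] by (auto simp: norm_index_def)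
    then have "norm_form n (S \<union> T, \<lambda>s. m s + k s) \<in> ?V" by (intro fp.span_base imageI)
    ultimately show "norm_form n (S, m) * norm_form n (T, k) \<in> ?V"
      by (simp add: norm_form_mult fp.span_zero fp.span_scale)
  qed
qed (rule fp.subspace_span)

section \<open>Comparison with the generated subalgebra\<close>

lemma subalgebra_scale_unit:
  assumes "fp_subalgebra T" "u \<in> {1, -1 :: int}"
  shows "of_int u * x \<in> T \<longleftrightarrow> x \<in> T"
proof -
  have scale: "of_int u * y \<in> T" if "y \<in> T" for y
    using assms(1) that by (simp add: fp_subalgebra_def of_int_mult_fp_scale fp.subspace_scale)
  have "of_int u * (of_int u * x) = x" using assms(2) by auto
  then show ?thesis using scale[of x] scale[of "of_int u * x"] by auto
qed

lemma subalgebra_power: "fp_subalgebra T \<Longrightarrow> x \<in> T \<Longrightarrow> x ^ k \<in> T"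
  by (induction k) (auto simp: fp_subalgebra_def)

lemma Bn_gens_in_span:
  assumes "odd CARD('p::prime_card)" and "n \<ge> 1"
  shows "Bn_gens n \<subseteq> (fp.span (norm_form n ` norm_index n) :: 'p fpoly fract exterior set)"
proof -
  let ?V = "fp.span (norm_form n ` norm_index n) :: 'p fpoly fract exterior set"
  have V: "fp_subalgebra ?V" by (rule fp_subalgebra_span_norm_form)
  have delta: "(\<Prod>s<n. qni n s ^ (if s = i then 1 else 0)) = (qni n i :: 'p fpoly fract)" if "i < n" for i
    using that by (subst prod.remove[of _ i]) auto
  \<comment> \<open>A single factor q_{n,0} satisfies the bound for up to two of the f_s; with S
    empty any q_{n,i} may stand alone.\<close>
  have base: "norm_form n (S, \<lambda>s. if s = i then 1 else 0) \<in> ?V"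
    if "S \<subseteq> {0..<n}" "i < n" "S = {} \<or> i = 0 \<and> card S \<le> 2" for S i
    using that by (intro fp.span_base imageI) (auto simp: norm_index_def)
  have "ext_const (qni n i) \<in> ?V" if "i < n" for i
    using base[of "{}" i] that by (simp add: norm_form_def delta)
  moreover have "to_loc (Rn n {s}) \<in> ?V" if s: "s < n" for s
  proof -
    obtain u :: int where "u \<in> {1, -1}"
      "to_loc (Rn n {s}) = of_int u * (ext_const (qni n 0) * dual_gen n s :: 'p fpoly fract exterior)"
      using Rn_dual_gen[OF s] .
    then show ?thesis
      using base[of "{s}" 0] s delta[of 0] subalgebra_scale_unit[OF V]
      by (simp add: norm_form_def ord_prod_def)
  qed
  moreover have "to_loc (Rn n {s, t}) \<in> ?V" if st: "s < t" "t < n" for s t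
  proof -
    obtain u :: int where "u \<in> {1, -1}" "to_loc (Rn n {s, t}) = of_int u *
        (ext_const (qni n 0) * (dual_gen n s * dual_gen n t) :: 'p fpoly fract exterior)"
      using Rn_pair_dual_gen[OF st assms(1)] .
    moreover have "ord_prod (dual_gen n) {s, t} = (dual_gen n s * dual_gen n t :: 'p fpoly fract exterior)"
      using st by (simp add: ord_prod_def)
    ultimately show ?thesis
      using base[of "{s, t}" 0] st delta[of 0] subalgebra_scale_unit[OF V]
      by (simp add: norm_form_def)
  qed
  ultimately show ?thesis by (auto simp: Bn_gens_def)
qed

text \<open>The factors are grouped in pairs, each of which absorbs one \<open>q\<^bsub>n,0\<^esub>\<close> and becomes \<open>\<plusminus>R\<^bsub>n;s,t\<^esub>\<close>.\<close>

lemma dual_gen_list_in_subalgebra: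
  fixes T :: "'p::prime_card fpoly fract exterior set"
  assumes p: "odd CARD('p)" and T: "fp_subalgebra T" "Bn_gens n \<subseteq> T"
    and "sorted xs" "distinct xs" "set xs \<subseteq> {0..<n}"
  shows "ext_const (qni n 0 ^ ((length xs + 1) div 2)) * prod_list (map (dual_gen n) xs) \<in> T"
  using assms(4-)
proof (induction xs rule: induct_list012)
  case 1
  then show ?case using T(1) by (simp add: fp_subalgebra_def)
next
  \<comment> \<open>An odd factor left over needs a whole q_{n,0} of its own, through R_{n;s}; hence
    the exponent is half the length rounded up.\<close>
  case (2 s)
  then have "s < n" by simp
  then obtain u :: int where "u \<in> {1, -1}"
    "to_loc (Rn n {s}) = of_int u * (ext_const (qni n 0) * dual_gen n s :: 'p fpoly fract exterior)"
    by (rule Rn_dual_gen)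
  moreover have "to_loc (Rn n {s}) \<in> T" using T(2) \<open>s < n\<close> by (auto simp: Bn_gens_def)
  ultimately show ?case using subalgebra_scale_unit[OF T(1)] by simp
next
  case (3 s t xs)
  then have st: "s < t" "t < n" by auto
  obtain u :: int where u: "u \<in> {1, -1}" "to_loc (Rn n {s, t}) = of_int u *
      (ext_const (qni n 0) * (dual_gen n s * dual_gen n t) :: 'p fpoly fract exterior)"
    using Rn_pair_dual_gen[OF st p] .
  have "to_loc (Rn n {s, t}) \<in> Bn_gens n" using st unfolding Bn_gens_def by blast
  then have "to_loc (Rn n {s, t}) \<in> T" using T(2) by blast
  then have "ext_const (qni n 0) * (dual_gen n s * dual_gen n t) \<in> T"
    using subalgebra_scale_unit[OF T(1)] u by simp
  moreover have "ext_const (qni n 0 ^ ((length xs + 1) div 2)) * prod_list (map (dual_gen n) xs) \<in> T"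
    using 3 by simp
  ultimately have "ext_const (qni n 0) * (dual_gen n s * dual_gen n t) *
      (ext_const (qni n 0 ^ ((length xs + 1) div 2)) * prod_list (map (dual_gen n) xs)) \<in> T"
    using T(1) unfolding fp_subalgebra_def by blast
  also have "ext_const (qni n 0) * (dual_gen n s * dual_gen n t) *
      (ext_const (qni n 0 ^ ((length xs + 1) div 2)) * prod_list (map (dual_gen n) xs)) =
    ext_const (qni n 0 ^ ((length (s # t # xs) + 1) div 2)) * prod_list (map (dual_gen n) (s # t # xs))"
    by (simp add: ext_const_mult mult.assoc ext_const_left_commute[of "dual_gen _ _"])
  finally show ?case .
qed

lemma norm_form_in_subalgebra:
  fixes T :: "'p::prime_card fpoly fract exterior set"
  assumes p: "odd CARD('p)" and T: "fp_subalgebra T" "Bn_gens n \<subseteq> T"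
    and x: "x \<in> norm_index n" and n: "n \<ge> 1"
  shows "norm_form n x \<in> T"
proof -
  obtain S m where S: "x = (S, m)" "S \<subseteq> {0..<n}" "card S \<le> 2 * m 0"
    using x by (auto simp: norm_index_def)
  have fin: "finite S" using S(2) finite_subset by blast
  \<comment> \<open>The share of q_{n,0} consumed in building f_S from the R's. It fits into
    \<open>m 0\<close> because \<open>card S\<close> \<le> 2 \<open>m 0\<close>, and the remaining
    powers are products of generators.\<close>
  let ?k = "(card S + 1) div 2"
  let ?m = "m(0 := m 0 - ?k)"
  have k: "?k \<le> m 0" using S(3) by simp
  have q: "ext_const (qni n s ^ j) \<in> T" if "s < n" for s j
    unfolding ext_const_power
    by (rule subalgebra_power[OF T(1)]) (use T(2) that in \<open>auto simp: Bn_gens_def\<close>)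
  have "ext_const (\<Prod>s\<in>A. qni n s ^ ?m s) \<in> T" if "A \<subseteq> {..<n}" for A
    using finite_subset[OF that finite_lessThan] that
  proof (induction A rule: finite_induct)
    case empty
    then show ?case using T(1) by (simp add: fp_subalgebra_def)
  next
    case (insert s A)
    then have "ext_const (qni n s ^ ?m s) * ext_const (\<Prod>s\<in>A. qni n s ^ ?m s) \<in> T"
      using T(1) q[of s "?m s"] unfolding fp_subalgebra_def by blast
    then show ?case using insert.hyps by (simp add: ext_const_mult del: fun_upd_apply)
  qed
  then have "ext_const (\<Prod>s<n. qni n s ^ ?m s) \<in> T" by blast
  moreover have "ext_const (qni n 0 ^ ?k) * ord_prod (dual_gen n) S \<in> T"
    using dual_gen_list_in_subalgebra[OF p T, of "sorted_list_of_set S"] S(2) fin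
    by (simp add: ord_prod_def)
  ultimately have "ext_const (\<Prod>s<n. qni n s ^ ?m s) * (ext_const (qni n 0 ^ ?k) * ord_prod (dual_gen n) S) \<in> T"
    using T(1) unfolding fp_subalgebra_def by blast
  moreover have "(\<Prod>s<n. qni n s ^ m s) = (\<Prod>s<n. qni n s ^ ?m s) * (qni n 0 ^ ?k :: 'p fpoly fract)"
  proof -
    have "0 \<in> {..<n}" using n by simp
    then show ?thesis
      using k by (simp add: prod.remove[of "{..<n}" 0] mult_ac flip: power_add)
  qed
  ultimately show ?thesis
    by (simp only: S(1) norm_form_def prod.case ext_const_mult mult.assoc)
qed

theorem proposition3p4:
  fixes n :: nat
  assumes "odd CARD('p::prime_card)" and "n \<ge> 1"
  shows "inj_on (qI n :: _ \<Rightarrow> 'p fpoly fract exterior) (admissible n)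
    \<and> fp.independent (qI n ` admissible n :: 'p fpoly fract exterior set)
    \<and> fp.span (qI n ` admissible n) = (Bn n :: 'p fpoly fract exterior set)"
proof -
  let ?V = "fp.span (norm_form n ` norm_index n) :: 'p fpoly fract exterior set"
  \<comment> \<open>Every subalgebra containing the generators contains all normal forms. This
    serves twice: for the lower bound on \<open>Bn n\<close>, and applied to the invariants to show
    that \<open>?V\<close> consists of invariants.\<close>
  have sub: "?V \<subseteq> T" if T: "fp_subalgebra T" "Bn_gens n \<subseteq> T" for T
    using T(1) norm_form_in_subalgebra[OF assms(1) T _ assms(2)]
    by (intro fp.span_minimal) (auto simp: fp_subalgebra_def)
  \<comment> \<open>Membership in the family defining the hull requires \<open>?V\<close> to be a
    subalgebra, to lie inside the invariants and to contain the generators.\<close>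
  have "Bn n \<subseteq> ?V"
    unfolding Bn_def
    by (intro hull_minimal conjI Bn_gens_in_span[OF assms] fp_subalgebra_span_norm_form
        sub[OF fp_subalgebra_invariants Bn_gens_invariant])
  moreover have "?V \<subseteq> Bn n"
    unfolding Bn_def hull_def using sub by blast
  ultimately show ?thesis
    using qI_independent[OF assms(2), where 'p = 'p] span_qI[OF assms(2), where 'p = 'p] by blast
qed

end
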